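(* Consider the linear model $Y = X\beta^{0} + \epsilon$ with a fixed design matrix $X\in\mathbb{R}^{n\times p}$, unknown $\beta^{0}\in\mathbb{R}^{p}$, and Gaussian noise $\epsilon\sim\mathcal{N}_{n}(0,\sigma_{0}^{2}I)$. Let $\Omega$ be a norm on $\mathbb{R}^{p}$, $\lambda>0$, and let $\hat\beta$ be a minimizer of $\beta\mapsto \|Y-X\beta\|_{n}^{2}+\lambda\Omega(\beta)$. Fix $J\subset\{1,\dots,p\}$ and $\lambda_J>0$, let $g$ be the gauge norm and $\Psi$ the matrix norm described in the context, and let $\hat B_J\in\mathbb{R}^{|J^{c}|\times|J|}$ be a minimizer of $$B\mapsto \|X_J - X_{J^{c}}B\|_{nuc} + \lambda_J\Psi(B).$$ Put $R:=X_J-X_{J^{c}}\hat B_J$ and assume $\|R\|_{nuc}\neq 0$, that $\hat\Sigma_J:=R^{T}R/n$ is non-singular and that $T_J:=R^{T}X_J/n$ is invertible. Define $M:=\sqrt{n}\,\hat\Sigma_J^{-1/2}T_J$ and $$\hat b_J:=\hat\beta_J + T_J^{-1}R^{T}(Y-X\hat\beta)/n .$$ Let $S_\star$ be an allowed set of $\Omega$ (in the paper, the oracle set of a sharp oracle inequality). Then $$M(\hat b_J-\beta^{0}_J)/\sigma_0 = W + rem,$$ where $W\sim\mathcal{N}_{|J|}(0,I)$ and the remainder satisfies $$\|rem\|_{\infty}\le \sqrt{n}\,\lambda_J\, g(\hat\beta_{J^{c}}-\beta^{0}_{J^{c}})/\sigma_0 \le \sqrt{n}\,\lambda_J\,\Upsilon_{S_\star}(\hat\beta-\beta^{0})/\sigma_0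 .$$
   Context: For $v\in\mathbb{R}^{n}$, $\|v\|_n^2:=\sum_{j=1}^n v_j^2/n$. For $J\subset\{1,\dots,p\}$ and $\beta\in\mathbb{R}^p$, $\beta_J$ denotes either the vector $(\beta_j)_{j\in J}$ or the vector in $\mathbb{R}^p$ with entries $\beta_j 1\{j\in J\}$, depending on context; $X_J$ is the submatrix of columns in $J$. The nuclear norm of a matrix $A$ is $\|A\|_{nuc}=\mathrm{tr}(\sqrt{A^{T}A})$, the sum of its singular values. A set $S\subset\{1,\dots,p\}$ is called allowed (for $\Omega$) if there is a norm $\Omega^{S^{c}}$ on $\mathbb{R}^{|S^{c}|}$ with $\Omega(\beta_S)+\Omega^{S^{c}}(\beta_{S^{c}})\le\Omega(\beta)$ for all $\beta\in\mathbb{R}^p$ (weak decomposability); for each allowed $S$ such a norm $\Omega^{S^c}$ is fixed and $\Upsilon_S(\beta):=\Omega(\beta_S)+\Omega^{S^{c}}(\beta_{S^{c}})$. For $\beta\in\mathbb{R}^p$ let $\beta_{f(J)}:=\beta_J-\beta_{J^{c}}$, and for $B\subset\mathbb{R}^p$ let $\mathrm{flip}_J(B):=\{\beta_{f(J)}:\beta\in B\}$. Let $\overline{B}:=\bigcup_{S\text{ allowed}}\{\beta:\Upsilon_S(\beta)\le 1\}$, $B_g:=\mathrm{Conv}(\overline{B}\cup\mathrm{flip}_J(\overline{B}))$, and let $g(x):=\inf\{t>0: x\in tB_g\}$ be its gauge. For $A\in\mathbb{R}^{|J^{c}|\times|J|}$ let $A_j\in\mathbb{R}^p$ be the $j$-th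 column of $A$ placed on the coordinates $J^{c}$ and zero on $J$, and $\Psi(A):=\sum_{j=1}^{|J|}g(A_j)$. *)

theory Defs
  imports "HOL-Analysis.Analysis" "HOL-Probability.Probability"
begin

text \<open>Vectors in R^p are real^'p; a J-subvector is represented by the vector in R^p
 with the other coordinates set to zero; a |A|x|B| matrix is represented as a padded
 matrix supported on the rows A and columns B.\<close>

definition restr :: "'p set \<Rightarrow> real^'p \<Rightarrow> real^'p" where
  "restr S v = (\<chi> i. if i \<in> S then v$i else 0)"

definition supp_on :: "'p set \<Rightarrow> (real^'p) set" where
  "supp_on S = {v. \<forall>i. i \<notin> S \<longrightarrow> v$i = 0}"

definition mat_supp :: "'m set \<Rightarrow> 'k set \<Rightarrow> (real^'k^'m) set" where
  "mat_supp A B = {M. \<forall>i j. (i \<notin> A \<or> j \<notin> B) \<longrightarrow> M$i$j = 0}"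

definition norm_on :: "(real^'p) set \<Rightarrow> (real^'p \<Rightarrow> real) \<Rightarrow> bool" where
  "norm_on V N \<longleftrightarrow> (\<forall>x\<in>V. 0 \<le> N x \<and> (N x = 0 \<longleftrightarrow> x = 0))
     \<and> (\<forall>c. \<forall>x\<in>V. N (c *\<^sub>R x) = \<bar>c\<bar> * N x)
     \<and> (\<forall>x\<in>V. \<forall>y\<in>V. N (x + y) \<le> N x + N y)"

definition is_norm :: "(real^'p \<Rightarrow> real) \<Rightarrow> bool" where
  "is_norm N \<longleftrightarrow> norm_on UNIV N"

definition allowed :: "(real^'p \<Rightarrow> real) \<Rightarrow> 'p set \<Rightarrow> bool" where
  "allowed Om S \<longleftrightarrow> (\<exists>N. norm_on (supp_on (- S)) N \<and>
      (\<forall>\<beta>. Om (restr S \<beta>) + N (restr (- S) \<beta>) \<le> Om \<beta>))"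

text \<open>OmC S is the fixed norm Omega^{S^c} chosen for each allowed S.\<close>
definition Upsilon :: "(real^'p \<Rightarrow> real) \<Rightarrow> ('p set \<Rightarrow> real^'p \<Rightarrow> real) \<Rightarrow> 'p set \<Rightarrow> real^'p \<Rightarrow> real" where
  "Upsilon Om OmC S \<beta> = Om (restr S \<beta>) + OmC S (restr (- S) \<beta>)"

definition Bbar :: "(real^'p \<Rightarrow> real) \<Rightarrow> ('p set \<Rightarrow> real^'p \<Rightarrow> real) \<Rightarrow> (real^'p) set" where
  "Bbar Om OmC = (\<Union>S\<in>{S. allowed Om S}. {\<beta>. Upsilon Om OmC S \<beta> \<le> 1})"

definition flip :: "'p set \<Rightarrow> real^'p \<Rightarrow> real^'p" where
  "flip J \<beta> = restr J \<beta> - restr (- J) \<beta>"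

definition Bg :: "(real^'p \<Rightarrow> real) \<Rightarrow> ('p set \<Rightarrow> real^'p \<Rightarrow> real) \<Rightarrow> 'p set \<Rightarrow> (real^'p) set" where
  "Bg Om OmC J = convex hull (Bbar Om OmC \<union> flip J ` Bbar Om OmC)"

definition gauge_g :: "(real^'p \<Rightarrow> real) \<Rightarrow> ('p set \<Rightarrow> real^'p \<Rightarrow> real) \<Rightarrow> 'p set \<Rightarrow> real^'p \<Rightarrow> real" where
  "gauge_g Om OmC J x = Inf {t. 0 < t \<and> x \<in> (\<lambda>y. t *\<^sub>R y) ` Bg Om OmC J}"

definition col_on :: "'p set \<Rightarrow> real^'p^'p \<Rightarrow> 'p \<Rightarrow> real^'p" where
  "col_on J B j = (\<chi> k. if k \<notin> J then B$k$j else 0)"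

definition Psi :: "(real^'p \<Rightarrow> real) \<Rightarrow> ('p set \<Rightarrow> real^'p \<Rightarrow> real) \<Rightarrow> 'p set \<Rightarrow> real^'p^'p \<Rightarrow> real" where
  "Psi Om OmC J B = (\<Sum>j\<in>J. gauge_g Om OmC J (col_on J B j))"

definition Xsub :: "real^'p^'n \<Rightarrow> 'p set \<Rightarrow> real^'p^'n" where
  "Xsub X J = (\<chi> i k. if k \<in> J then X$i$k else 0)"

definition psd_sqrt :: "real^'n^'n \<Rightarrow> real^'n^'n" where
  "psd_sqrt A = (THE S. transpose S = S \<and> (\<forall>x. 0 \<le> x \<bullet> (S *v x)) \<and> S ** S = A)"

definition nuc :: "real^'p^'n \<Rightarrow> real" where
  "nuc A = trace (psd_sqrt (transpose A ** A))"

definition Jid :: "'p set \<Rightarrow> real^'p^'p" where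
  "Jid J = (\<chi> i j. if i = j \<and> i \<in> J then 1 else 0)"

definition Jinvertible :: "'p set \<Rightarrow> real^'p^'p \<Rightarrow> bool" where
  "Jinvertible J A \<longleftrightarrow> (\<exists>S\<in>mat_supp J J. S ** A = Jid J \<and> A ** S = Jid J)"

definition Jinv :: "'p set \<Rightarrow> real^'p^'p \<Rightarrow> real^'p^'p" where
  "Jinv J A = (THE S. S \<in> mat_supp J J \<and> S ** A = Jid J \<and> A ** S = Jid J)"

definition sqnorm_n :: "real^'n \<Rightarrow> real" where
  "sqnorm_n v = (\<Sum>i\<in>UNIV. (v$i)^2) / real CARD('n)"

end

theory Submission
  imports Defs
begin

text \<open>
  Let \<open>Q\<close> be the positive semidefinite square root of \<open>R\<^sup>T R\<close>, which is invertible on \<open>J\<close> with inverse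
  \<open>N\<close>. Then \<open>M = n N T\<^sub>J\<close>, and expanding \<open>Y - X \<beta>\<close> gives
  \<open>M (b\<^sub>J - \<beta>\<^sup>0\<^sub>J) = N R\<^sup>T \<epsilon> - N R\<^sup>T X\<^bsub>J\<^sup>c\<^esub> (\<beta> - \<beta>\<^sup>0)\<^bsub>J\<^sup>c\<^esub>\<close>. The rows of \<open>N R\<^sup>T\<close> indexed by \<open>J\<close> are
  orthonormal since \<open>N R\<^sup>T R N\<close> is the identity on \<open>J\<close>, so the first term is Gaussian by rotation
  invariance. The second term is controlled by the optimality of \<open>B\<^sub>J\<close>: the nuclear norm has at \<open>R\<close> the
  quadratic majorant \<open>(tr (N A\<^sup>T A) + tr Q) / 2\<close>, whose derivative is \<open>R N\<close>, and perturbing \<open>B\<^sub>J\<close> in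
  its \<open>j\<close>-th column along \<open>d\<close> bounds \<open>(N R\<^sup>T X\<^bsub>J\<^sup>c\<^esub> d)\<^sub>j\<close> by \<open>\<lambda>\<^sub>J g d\<close>.
\<close>

section \<open>Positive semidefinite square roots\<close>

lemma inner_matrix_vector_mult_transpose:
  fixes A :: "real^'k^'m"
  shows "x \<bullet> (A *v y) = (transpose A *v x) \<bullet> y"
  by (metis dot_lmul_matrix vector_transpose_matrix transpose_transpose)

text \<open>Let \<open>t\<close> tend to 0. This turns an extremality inequality, once divided by
  the step size, into a first-order condition, both for the Rayleigh quotient and for the nuclear
  norm problem.\<close>

lemma le_zero_if_le_small_multiple:
  fixes a b :: real
  assumes "\<And>t. t > 0 \<Longrightarrow> a \<le> t * b"
  shows "a \<le> 0"
proof (rule ccontr)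
  assume "\<not> a \<le> 0"
  then have a: "a > 0" by simp
  \<comment> \<open>The step is chosen so that its multiple of \<open>b\<close> is at most
    \<open>a / 2\<close>; the added 1 covers \<open>b = 0\<close>.\<close>
  have "a \<le> (a / (2 * (\<bar>b\<bar> + 1))) * b"
    using a by (intro assms divide_pos_pos) auto
  also have "\<dots> \<le> (a / (2 * (\<bar>b\<bar> + 1))) * (\<bar>b\<bar> + 1)"
    using a by (intro mult_left_mono) auto
  also have "\<dots> = a / 2"
    by (simp add: field_simps)
  finally show False using a by simp
qed

section \<open>Spectral theorem for self-adjoint maps and symmetric matrices\<close>

text \<open>A maximiser \<open>v\<close> of the Rayleigh quotient on the unit sphere of
  \<open>V\<close> exists by compactness. The residual \<open>w\<close> of \<open>f v\<close> lies
  in \<open>V\<close> by invariance and is orthogonal to \<open>v\<close>; varying \<open>v\<close>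
  along \<open>w\<close> forces it to vanish.\<close>

lemma selfadjoint_eigenvector:
  fixes f :: "'a::euclidean_space \<Rightarrow> 'a"
  assumes lin: "linear f" and adj: "\<And>x y. f x \<bullet> y = x \<bullet> f y"
    and V: "subspace V" and inv: "f ` V \<subseteq> V" and ne: "V \<noteq> {0}"
  obtains v c where "v \<in> V" "norm v = 1" "f v = c *\<^sub>R v"
proof -
  let ?K = "sphere 0 1 \<inter> V"
  obtain u where u: "u \<in> V" "u \<noteq> 0"
    using ne subspace_0[OF V] by blast
  have "(1 / norm u) *\<^sub>R u \<in> ?K"
    using u V by (auto intro: subspace_scale)
  then have K: "?K \<noteq> {}" by blast
  have comp: "compact ?K"
    using V by (intro compact_Int_closed closed_subspace) auto
  have cont: "continuous_on ?K (\<lambda>x. x \<bullet> f x)"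
    using lin by (intro continuous_intros linear_continuous_on) (simp add: linear_conv_bounded_linear)
  obtain v where v: "v \<in> ?K" and mx: "\<And>y. y \<in> ?K \<Longrightarrow> y \<bullet> f y \<le> v \<bullet> f v"
    using continuous_attains_sup[OF comp K cont] by blast
  define c where "c = v \<bullet> f v"
  have vV: "v \<in> V" and nv: "norm v = 1" using v by auto
  have vv: "v \<bullet> v = 1" using nv by (simp add: norm_eq_1)
  have le: "x \<bullet> f x \<le> c * (x \<bullet> x)" if "x \<in> V" for x
  proof (cases "x = 0")
    case True
    then show ?thesis by simp
  next
    case False
    then have "(1 / norm x) *\<^sub>R x \<in> ?K"
      using that V by (auto intro: subspace_scale)
    from mx[OF this] have "(x \<bullet> f x) / (norm x)\<^sup>2 \<le> c"
      using False by (simp add: linear_scale[OF lin] c_def power2_eq_square divide_simps)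
    then show ?thesis
      using False by (simp add: divide_simps power2_norm_eq_inner split: if_splits)
  qed
  define w where "w = f v - c *\<^sub>R v"
  have wV: "w \<in> V"
    unfolding w_def using vV inv V by (intro subspace_diff subspace_scale) auto
  have wv: "w \<bullet> v = 0" by (simp add: w_def inner_diff_left vv c_def inner_commute[of "f v" v])
  have wfv: "w \<bullet> f v = w \<bullet> w"
    using wv by (simp add: w_def inner_diff_right)
  have wfv': "v \<bullet> f w = w \<bullet> w"
    using adj[of v w] wfv by (simp add: inner_commute)
  \<comment> \<open>The Rayleigh inequality at \<open>v + t w\<close>: the terms of order 0 cancel,
    and those of order 1 sum to twice \<open>w \<bullet> w\<close>.\<close>
  have "2 * (w \<bullet> w) \<le> t * (c * (w \<bullet> w) - w \<bullet> f w)" if "t > 0" for t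
  proof -
    have "(v + t *\<^sub>R w) \<bullet> f (v + t *\<^sub>R w) \<le> c * ((v + t *\<^sub>R w) \<bullet> (v + t *\<^sub>R w))"
      using vV wV V by (intro le subspace_add subspace_scale)
    then have "t * (2 * (w \<bullet> w)) \<le> t * (t * (c * (w \<bullet> w) - w \<bullet> f w))"
      using wv by (simp add: linear_add[OF lin] linear_scale[OF lin] inner_add_left inner_add_right
            c_def[symmetric] wfv wfv' vv inner_commute[of v w] algebra_simps)
    then show ?thesis using that by simp
  qed
  then have "2 * (w \<bullet> w) \<le> 0" by (rule le_zero_if_le_small_multiple)
  then have "w = 0" by (metis inner_gt_zero_iff mult_pos_pos not_le zero_less_numeral)
  then have "f v = c *\<^sub>R v" by (simp add: w_def)
  with that vV nv show thesis by blast
qed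

text \<open>Induction on the dimension: split off one unit eigenvector. Self-adjointness makes its
  orthogonal complement in \<open>V\<close> invariant.\<close>

lemma selfadjoint_eigenbasis_subspace:
  fixes f :: "'a::euclidean_space \<Rightarrow> 'a"
  assumes lin: "linear f" and adj: "\<And>x y. f x \<bullet> y = x \<bullet> f y"
    and V: "subspace V" and inv: "f ` V \<subseteq> V"
  shows "\<exists>B. finite B \<and> B \<subseteq> V \<and> pairwise orthogonal B \<and> (\<forall>b\<in>B. norm b = 1) \<and> span B = V
      \<and> (\<forall>b\<in>B. \<exists>c. f b = c *\<^sub>R b)"
  using V inv
proof (induction "dim V" arbitrary: V rule: less_induct)
  case (less V)
  note V = \<open>subspace V\<close> and inv = \<open>f ` V \<subseteq> V\<close>
  show ?case
  proof (cases "V = {0}")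
    case True
    then show ?thesis by (intro exI[of _ "{}"]) simp
  next
    case False
    then obtain v c where v: "v \<in> V" "norm v = 1" "f v = c *\<^sub>R v"
      using selfadjoint_eigenvector[OF lin adj V inv] by blast
    have vv: "v \<bullet> v = 1" using v by (simp add: norm_eq_1)
    define V' where "V' = V \<inter> {x. v \<bullet> x = 0}"
    have V': "subspace V'"
      unfolding V'_def by (rule subspace_inter[OF V subspace_hyperplane])
    have inv': "f ` V' \<subseteq> V'"
    proof
      fix y assume "y \<in> f ` V'"
      then obtain x where x: "x \<in> V" "v \<bullet> x = 0" "y = f x" by (auto simp: V'_def)
      have "v \<bullet> f x = f v \<bullet> x" by (simp add: adj)
      also have "\<dots> = 0" by (simp add: v x)
      finally show "y \<in> V'" using x inv by (auto simp: V'_def)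
    qed
    have "v \<notin> V'" by (simp add: V'_def vv)
    then have "V' \<subset> V" using v unfolding V'_def by blast
    then have "dim V' < dim V"
      by (metis V V' dim_psubset span_eq_iff)
    from less.hyps[OF this V' inv'] obtain B where
      B: "finite B" "B \<subseteq> V'" "pairwise orthogonal B" "\<And>b. b \<in> B \<Longrightarrow> norm b = 1" "span B = V'"
         "\<And>b. b \<in> B \<Longrightarrow> \<exists>c. f b = c *\<^sub>R b" by blast
    have "pairwise orthogonal (insert v B)"
      using B(2,3) by (auto simp: pairwise_insert orthogonal_def V'_def inner_commute)
    moreover have "span (insert v B) = V"
    proof
      show "span (insert v B) \<subseteq> V"
        using B(2) v V by (intro span_minimal) (auto simp: V'_def)
      show "V \<subseteq> span (insert v B)"
      proof
        fix x assume x: "x \<in> V"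
        have "x - (v \<bullet> x) *\<^sub>R v \<in> V'"
          unfolding V'_def using x v V vv by (auto intro: subspace_diff subspace_scale simp: inner_diff_right)
        then show "x \<in> span (insert v B)"
          unfolding span_insert B(5) by blast
      qed
    qed
    ultimately show ?thesis
      using B v by (intro exI[of _ "insert v B"]) (auto simp: V'_def)
  qed
qed

lemma symmetric_matrix_eigenbasis:
  fixes A :: "real^'n^'n"
  assumes "transpose A = A"
  obtains B c where "finite B" "pairwise orthogonal B" "\<And>b. b \<in> B \<Longrightarrow> norm b = 1" "span B = UNIV"
    "\<And>b. b \<in> B \<Longrightarrow> A *v b = c b *\<^sub>R b"
proof -
  have "\<exists>B. finite B \<and> B \<subseteq> UNIV \<and> pairwise orthogonal B \<and> (\<forall>b\<in>B. norm b = 1) \<and> span B = UNIV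
      \<and> (\<forall>b\<in>B. \<exists>c. A *v b = c *\<^sub>R b)"
    using assms
    by (intro selfadjoint_eigenbasis_subspace)
      (auto simp: inner_matrix_vector_mult_transpose)
  then show thesis using that by metis
qed

section \<open>Uniqueness and existence of the square root\<close>

text \<open>For \<open>c > 0\<close>, the vector \<open>z = S b - sqrt c b\<close> satisfies
  \<open>S z = - sqrt c z\<close>, which positivity forbids unless \<open>z = 0\<close>. So a root
  is determined on an eigenbasis of its square, which gives uniqueness.\<close>

lemma psd_square_root_eigenvector:
  fixes S :: "real^'n^'n"
  assumes sym: "transpose S = S" and psd: "\<And>x. 0 \<le> x \<bullet> (S *v x)"
    and eig: "(S ** S) *v b = c *\<^sub>R b" and b: "norm b = 1"
  shows "S *v b = sqrt c *\<^sub>R b"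
proof -
  have SS: "S *v (S *v b) = c *\<^sub>R b"
    using eig by (simp add: matrix_vector_mul_assoc)
  have bb: "b \<bullet> b = 1" using b by (simp add: norm_eq_1)
  have "(S *v b) \<bullet> (S *v b) = c"
    using SS bb sym by (metis inner_matrix_vector_mult_transpose inner_scaleR_right mult.right_neutral)
  then have c0: "c \<ge> 0" by (metis inner_ge_zero)
  show ?thesis
  proof (cases "c = 0")
    case True
    then show ?thesis using \<open>(S *v b) \<bullet> (S *v b) = c\<close> by simp
  next
    case False
    define z where "z = S *v b - sqrt c *\<^sub>R b"
    have "S *v z = - (sqrt c *\<^sub>R z)"
      using c0 by (simp add: z_def matrix_vector_mult_diff_distrib matrix_vector_mult_scaleR SS
          scaleR_diff_right)
    then have "z \<bullet> (S *v z) = - (sqrt c * (z \<bullet> z))" by simp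
    with psd[of z] have "sqrt c * (z \<bullet> z) \<le> 0" by simp
    moreover have "sqrt c > 0" using False c0 by simp
    ultimately have "z = 0"
      by (metis inner_gt_zero_iff mult_pos_pos not_le)
    then show ?thesis by (simp add: z_def)
  qed
qed

lemma psd_square_root_unique:
  fixes S T :: "real^'n^'n"
  assumes S: "transpose S = S" "\<And>x. 0 \<le> x \<bullet> (S *v x)"
    and T: "transpose T = T" "\<And>x. 0 \<le> x \<bullet> (T *v x)"
    and eq: "S ** S = T ** T"
  shows "S = T"
proof -
  have "transpose (S ** S) = S ** S" by (simp add: matrix_transpose_mul S)
  then obtain B c where B: "\<And>b. b \<in> B \<Longrightarrow> norm b = 1" "span B = UNIV"
      "\<And>b. b \<in> B \<Longrightarrow> (S ** S) *v b = c b *\<^sub>R b"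
    by (metis symmetric_matrix_eigenbasis)
  have "S *v b = T *v b" if "b \<in> B" for b
    using psd_square_root_eigenvector[OF S B(3)[OF that] B(1)[OF that]]
      psd_square_root_eigenvector[OF T B(3)[OF that, unfolded eq] B(1)[OF that]] by simp
  then have "S *v x = T *v x" for x
    using linear_eq_on_span[of "(*v) S" "(*v) T" B x] B(2) by simp
  then show ?thesis by (simp add: matrix_eq)
qed

lemma psd_square_root_exists:
  fixes A :: "real^'n^'n"
  assumes sym: "transpose A = A" and psd: "\<And>x. 0 \<le> x \<bullet> (A *v x)"
  shows "\<exists>S. transpose S = S \<and> (\<forall>x. 0 \<le> x \<bullet> (S *v x)) \<and> S ** S = A"
proof -
  obtain B c where B: "finite B" "pairwise orthogonal B" "\<And>b. b \<in> B \<Longrightarrow> norm b = 1" "span B = UNIV"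
      "\<And>b. b \<in> B \<Longrightarrow> A *v b = c b *\<^sub>R b"
    using symmetric_matrix_eigenbasis[OF sym] by metis
  have c0: "c b \<ge> 0" if "b \<in> B" for b
    using psd[of b] B(3)[OF that] by (simp add: B(5)[OF that] norm_eq_1)
  \<comment> \<open>Spectral calculus supplies the witness: keep the eigenbasis of \<open>A\<close>
    and replace each eigenvalue by its root.\<close>
  define g where "g = (\<lambda>x. \<Sum>b\<in>B. (sqrt (c b) * (b \<bullet> x)) *\<^sub>R b)"
  have lin: "linear g"
    by (rule linearI) (simp_all add: g_def inner_add_right distrib_left scaleR_add_left sum.distrib
        scaleR_sum_right mult.left_commute)
  define S where "S = matrix g"
  have Sg: "S *v x = g x" for x
    using lin by (simp add: S_def)
  have inner: "x \<bullet> g y = (\<Sum>b\<in>B. sqrt (c b) * (b \<bullet> y) * (b \<bullet> x))" for x y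
    by (simp add: g_def inner_sum_right inner_commute[of x])
  have gb: "g b = sqrt (c b) *\<^sub>R b" if "b \<in> B" for b
  proof -
    have "(sqrt (c a) * (a \<bullet> b)) *\<^sub>R a = (if a = b then sqrt (c b) *\<^sub>R b else 0)" if "a \<in> B" for a
      using that \<open>b \<in> B\<close> B(2,3) by (auto simp: pairwise_def orthogonal_def norm_eq_1)
    then have "g b = (\<Sum>a\<in>B. if a = b then sqrt (c b) *\<^sub>R b else 0)"
      unfolding g_def by (intro sum.cong) auto
    then show ?thesis using that B(1) by simp
  qed
  have "(transpose S *v x) \<bullet> y = (S *v x) \<bullet> y" for x y
  proof -
    have "(transpose S *v x) \<bullet> y = x \<bullet> g y"
      by (simp only: inner_matrix_vector_mult_transpose[symmetric] Sg)
    also have "\<dots> = y \<bullet> g x"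
      by (simp add: inner mult.commute mult.left_commute)
    finally show ?thesis by (simp add: Sg inner_commute)
  qed
  then have "transpose S *v x = S *v x" for x
    by (metis vector_eq_rdot)
  then have "transpose S = S" by (simp add: matrix_eq)
  moreover have "0 \<le> x \<bullet> (S *v x)" for x
    unfolding Sg inner using c0 by (intro sum_nonneg) (simp add: mult.assoc)
  moreover have "S ** S = A"
  proof -
    have "(S ** S) *v b = A *v b" if "b \<in> B" for b
      using that c0[OF that] B(5)[OF that]
      by (simp add: matrix_vector_mul_assoc[symmetric] Sg gb linear_scale[OF lin])
    then have "(S ** S) *v x = A *v x" for x
      using linear_eq_on_span[of "(*v) (S ** S)" "(*v) A" B x] B(4) by simp
    then show ?thesis by (simp add: matrix_eq)
  qed
  ultimately show ?thesis by blast
qed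

lemma psd_sqrt_eqI:
  fixes S :: "real^'n^'n"
  assumes "transpose S = S" "\<And>x. 0 \<le> x \<bullet> (S *v x)" "S ** S = A"
  shows "psd_sqrt A = S"
  unfolding psd_sqrt_def
  using assms by (intro the_equality) (auto intro!: psd_square_root_unique)

lemma psd_sqrt_gram:
  fixes A :: "real^'p^'n"
  shows "transpose (psd_sqrt (transpose A ** A)) = psd_sqrt (transpose A ** A)"
    and "0 \<le> x \<bullet> (psd_sqrt (transpose A ** A) *v x)"
    and "psd_sqrt (transpose A ** A) ** psd_sqrt (transpose A ** A) = transpose A ** A"
proof -
  have "transpose (transpose A ** A) = transpose A ** A"
    by (simp add: matrix_transpose_mul)
  moreover have "0 \<le> x \<bullet> ((transpose A ** A) *v x)" for x
    by (metis inner_ge_zero inner_matrix_vector_mult_transpose matrix_vector_mul_assoc transpose_transpose)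
  ultimately obtain S where "transpose S = S" "\<And>x. 0 \<le> x \<bullet> (S *v x)" "S ** S = transpose A ** A"
    using psd_square_root_exists by metis
  moreover from this have "psd_sqrt (transpose A ** A) = S" by (rule psd_sqrt_eqI)
  ultimately show "transpose (psd_sqrt (transpose A ** A)) = psd_sqrt (transpose A ** A)"
    "0 \<le> x \<bullet> (psd_sqrt (transpose A ** A) *v x)"
    "psd_sqrt (transpose A ** A) ** psd_sqrt (transpose A ** A) = transpose A ** A"
    by auto
qed

section \<open>Matrices supported on index sets and the nuclear norm\<close>

lemma matrix_mult_diff_left: "((A::real^'k^'m) - B) ** C = A ** C - B ** C"
  by (simp add: matrix_matrix_mult_def vec_eq_iff left_diff_distrib sum_subtractf)

lemma matrix_mult_diff_right: "(A::real^'k^'m) ** (B - C) = A ** B - A ** C"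
  by (simp add: matrix_matrix_mult_def vec_eq_iff right_diff_distrib sum_subtractf)

lemma matrix_mult_scaleR_left: "(c *\<^sub>R (A::real^'k^'m)) ** B = c *\<^sub>R (A ** B)"
  by (simp add: scalar_matrix_assoc)

lemma matrix_mult_scaleR_right: "(A::real^'k^'m) ** (c *\<^sub>R B) = c *\<^sub>R (A ** B)"
  by (simp add: scalar_matrix_assoc matrix_scalar_ac)

lemma transpose_diff: "transpose ((A::real^'k^'m) - B) = transpose A - transpose B"
  by (simp add: transpose_def vec_eq_iff)

lemma trace_scaleR: "trace (c *\<^sub>R (A::real^'k^'k)) = c * trace A"
  by (simp add: trace_def sum_distrib_left)

lemma trace_transpose: "trace (transpose (A::real^'k^'k)) = trace A"
  by (simp add: trace_def transpose_def)

text \<open>Each diagonal entry is the quadratic form of \<open>N\<close> at a column of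
  \<open>E\<close>.\<close>

lemma trace_congruence_nonneg:
  fixes N :: "real^'k^'k" and E :: "real^'m^'k"
  assumes "\<And>x. 0 \<le> x \<bullet> (N *v x)"
  shows "0 \<le> trace (transpose E ** N ** E)"
proof -
  have "(transpose E ** N ** E) $ i $ i = (column i E) \<bullet> (N *v column i E)" for i
    by (simp add: matrix_matrix_mult_def matrix_vector_mult_def inner_vec_def column_def transpose_def
        sum_distrib_left sum_distrib_right mult.assoc)
      (rule sum.swap)
  then show ?thesis
    using assms by (simp add: trace_def sum_nonneg)
qed

text \<open>Pairing with a direction that changes one column isolates one coordinate; this is how
  optimality of a matrix becomes an entrywise bound.\<close>

lemma trace_mult_single_column:
  fixes A :: "real^'k^'m"
  shows "trace (A ** (\<chi> k l. if l = j then d $ k else 0)) = (A *v d) $ j"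
  by (simp add: trace_def matrix_matrix_mult_def matrix_vector_mult_def if_distrib
      sum.delta cong: if_cong)
    (simp add: sum.If_cases if_distrib)

section \<open>Padded matrices, their inverses and roots on an index set\<close>

lemma mat_supp_mult:
  fixes A :: "real^'k^'m" and B :: "real^'l^'k"
  assumes "A \<in> mat_supp I K" "B \<in> mat_supp L J"
  shows "A ** B \<in> mat_supp I J"
  using assms by (auto simp: mat_supp_def matrix_matrix_mult_def)

lemma mat_supp_transpose: "A \<in> mat_supp I J \<Longrightarrow> transpose A \<in> mat_supp J I"
  by (auto simp: mat_supp_def transpose_def)

lemma mat_supp_diff: "A \<in> mat_supp I J \<Longrightarrow> B \<in> mat_supp I J \<Longrightarrow> (A::real^'k^'m) - B \<in> mat_supp I J"
  by (auto simp: mat_supp_def)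

lemma mat_supp_add: "A \<in> mat_supp I J \<Longrightarrow> B \<in> mat_supp I J \<Longrightarrow> (A::real^'k^'m) + B \<in> mat_supp I J"
  by (auto simp: mat_supp_def)

lemma mat_supp_scaleR: "A \<in> mat_supp I J \<Longrightarrow> c *\<^sub>R (A::real^'k^'m) \<in> mat_supp I J"
  by (auto simp: mat_supp_def)

lemma Xsub_mat_supp: "Xsub X J \<in> mat_supp UNIV J"
  by (auto simp: mat_supp_def Xsub_def)

text \<open>\<open>Jid J\<close> is the unit among matrices supported on \<open>J\<close>, so it
  takes the place of the identity for padded blocks.\<close>

lemma Jid_mult_left:
  assumes "A \<in> mat_supp J K"
  shows "Jid J ** A = A"
proof -
  have "(\<Sum>k\<in>UNIV. (if i = k \<and> i \<in> J then 1 else 0) * A $ k $ l) = A $ i $ l" for i l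
  proof -
    have "(\<Sum>k\<in>UNIV. (if i = k \<and> i \<in> J then 1 else 0) * A $ k $ l)
        = (\<Sum>k\<in>UNIV. if i = k then A $ k $ l else 0)"
      using assms by (intro sum.cong) (auto simp: mat_supp_def)
    then show ?thesis by simp
  qed
  then show ?thesis by (simp add: Jid_def matrix_matrix_mult_def vec_eq_iff)
qed

lemma transpose_Jid: "transpose (Jid J) = Jid J"
  by (auto simp: transpose_def Jid_def vec_eq_iff)

lemma Jid_mult_right:
  assumes "A \<in> mat_supp I J"
  shows "A ** Jid J = A"
  by (metis Jid_mult_left[OF mat_supp_transpose[OF assms]] matrix_transpose_mul transpose_Jid
      transpose_transpose)

lemma left_inverse_eq_right_inverse_Jid:
  assumes "S \<in> mat_supp J J" "T \<in> mat_supp J J" "S ** A = Jid J" "A ** T = Jid J"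
  shows "S = T"
  by (metis assms Jid_mult_left Jid_mult_right matrix_mul_assoc)

lemma Jinv_eqI:
  assumes "S \<in> mat_supp J J" "S ** A = Jid J" "A ** S = Jid J"
  shows "Jinv J A = S"
  unfolding Jinv_def
  using assms by (intro the_equality) (auto intro: left_inverse_eq_right_inverse_Jid)

lemma Jinv_props:
  assumes "Jinvertible J A"
  shows "Jinv J A \<in> mat_supp J J" "Jinv J A ** A = Jid J" "A ** Jinv J A = Jid J"
  using assms Jinv_eqI unfolding Jinvertible_def by metis+

text \<open>For \<open>j\<close> outside \<open>J\<close> the column \<open>A e_j\<close> vanishes,
  so \<open>e_j \<bullet> Q (Q e_j)\<close>, the squared length of \<open>Q e_j\<close>, is 0.
  Symmetry then handles the rows.\<close>

lemma psd_sqrt_gram_mat_supp: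
  fixes A :: "real^'p^'n"
  assumes "A \<in> mat_supp UNIV J"
  shows "psd_sqrt (transpose A ** A) \<in> mat_supp J J"
proof -
  let ?Q = "psd_sqrt (transpose A ** A)"
  have z: "?Q $ i $ j = 0" if "j \<notin> J" for i j
  proof -
    have "A *v axis j 1 = 0"
      using assms that by (simp add: matrix_vector_mult_basis column_def mat_supp_def vec_eq_iff)
    then have "(?Q ** ?Q) *v axis j 1 = 0"
      by (simp add: psd_sqrt_gram(3) matrix_vector_mul_assoc[symmetric])
    then have "axis j 1 \<bullet> (?Q *v (?Q *v axis j 1)) = 0"
      by (simp add: matrix_vector_mul_assoc)
    then have "?Q *v axis j 1 = 0"
      by (metis inner_eq_zero_iff inner_matrix_vector_mult_transpose psd_sqrt_gram(1))
    then show ?thesis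
      by (simp add: matrix_vector_mult_basis column_def vec_eq_iff)
  qed
  have "?Q $ i $ j = ?Q $ j $ i" for i j
    using arg_cong[OF psd_sqrt_gram(1)[of A], of "\<lambda>M. M $ j $ i"] by (simp add: transpose_def)
  with z show ?thesis
    unfolding mat_supp_def mem_Collect_eq by metis
qed

lemma psd_sqrt_scaleR_gram:
  fixes A :: "real^'p^'n"
  assumes "0 \<le> c"
  shows "psd_sqrt (c *\<^sub>R (transpose A ** A)) = sqrt c *\<^sub>R psd_sqrt (transpose A ** A)"
proof (rule psd_sqrt_eqI)
  show "transpose (sqrt c *\<^sub>R psd_sqrt (transpose A ** A)) = sqrt c *\<^sub>R psd_sqrt (transpose A ** A)"
    by (simp add: transpose_scalar psd_sqrt_gram(1))
  show "0 \<le> x \<bullet> ((sqrt c *\<^sub>R psd_sqrt (transpose A ** A)) *v x)" for x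
    using assms psd_sqrt_gram(2)[of x A] by (simp add: scaleR_matrix_vector_assoc[symmetric])
  show "(sqrt c *\<^sub>R psd_sqrt (transpose A ** A)) ** (sqrt c *\<^sub>R psd_sqrt (transpose A ** A))
      = c *\<^sub>R (transpose A ** A)"
    using assms by (simp add: matrix_mult_scaleR_left matrix_mult_scaleR_right psd_sqrt_gram(3))
qed

text \<open>The transpose is again an inverse. For positivity, with \<open>y\<close> the image of
  \<open>x\<close> under the inverse, \<open>x \<bullet> y\<close> equals
  \<open>y \<bullet> (S *v y)\<close>.\<close>

lemma Jinv_symmetric_psd:
  fixes S :: "real^'p^'p"
  assumes S: "transpose S = S" "\<And>x. 0 \<le> x \<bullet> (S *v x)"
    and inv: "Jinvertible J S"
  shows "transpose (Jinv J S) = Jinv J S" and "0 \<le> x \<bullet> (Jinv J S *v x)"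
proof -
  note P = Jinv_props[OF inv]
  show sym: "transpose (Jinv J S) = Jinv J S"
  proof (rule sym, rule Jinv_eqI)
    show "transpose (Jinv J S) \<in> mat_supp J J" using P(1) by (rule mat_supp_transpose)
    show "transpose (Jinv J S) ** S = Jid J"
      by (metis P(3) S(1) matrix_transpose_mul transpose_Jid)
    show "S ** transpose (Jinv J S) = Jid J"
      by (metis P(2) S(1) matrix_transpose_mul transpose_Jid)
  qed
  let ?y = "Jinv J S *v x"
  have "x \<bullet> ?y = x \<bullet> ((Jinv J S ** S) *v ?y)"
    by (metis Jid_mult_left P(1) P(2) matrix_vector_mul_assoc)
  also have "\<dots> = ?y \<bullet> (S *v ?y)"
    by (metis sym inner_matrix_vector_mult_transpose matrix_vector_mul_assoc)
  finally show "0 \<le> x \<bullet> ?y" using S(2) by simp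
qed

text \<open>If \<open>K\<close> inverts the square of the root \<open>S\<close>, then
  \<open>K ** S\<close> is a left and \<open>S ** K\<close> a right inverse of \<open>S\<close>, and
  the two agree.\<close>

lemma Jinvertible_psd_sqrt_gram:
  fixes A :: "real^'p^'n"
  assumes A: "A \<in> mat_supp UNIV J" and inv: "Jinvertible J (transpose A ** A)"
  shows "Jinvertible J (psd_sqrt (transpose A ** A))"
proof -
  let ?S = "psd_sqrt (transpose A ** A)" and ?K = "Jinv J (transpose A ** A)"
  note K = Jinv_props[OF inv]
  have S: "?S \<in> mat_supp J J" using A by (rule psd_sqrt_gram_mat_supp)
  have l: "(?K ** ?S) ** ?S = Jid J"
    by (simp add: matrix_mul_assoc[symmetric] psd_sqrt_gram(3) K)
  have r: "?S ** (?S ** ?K) = Jid J"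
    by (simp add: matrix_mul_assoc psd_sqrt_gram(3) K)
  have m: "?K ** ?S \<in> mat_supp J J" "?S ** ?K \<in> mat_supp J J"
    using S K(1) by (auto intro: mat_supp_mult)
  have "?K ** ?S = ?S ** ?K"
    using m l r by (rule left_inverse_eq_right_inverse_Jid)
  then show ?thesis
    unfolding Jinvertible_def using m(1) l r by (intro bexI[of _ "?K ** ?S"]) auto
qed

text \<open>With \<open>D\<close> the square root of the Gram matrix of \<open>A\<close>, this is the nonnegativity of the trace of
  \<open>(D - Q) Q\<^sup>-\<^sup>1 (D - Q)\<close>; equality holds for \<open>D = Q\<close>, so the right-hand side is a smooth majorant of
  the nuclear norm.\<close>
lemma nuc_le_quadratic_majorant:
  fixes A :: "real^'p^'n" and Q N :: "real^'p^'p"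
  assumes A: "A \<in> mat_supp UNIV J" and Q: "Q \<in> mat_supp J J" "transpose Q = Q"
    and N: "\<And>x. 0 \<le> x \<bullet> (N *v x)"
    and NQ: "N ** Q = Jid J" "Q ** N = Jid J"
  shows "2 * nuc A \<le> trace (N ** (transpose A ** A)) + trace Q"
proof -
  define D where "D = psd_sqrt (transpose A ** A)"
  have D: "transpose D = D" "D ** D = transpose A ** A" "D \<in> mat_supp J J"
    using psd_sqrt_gram(1,3)[of A] psd_sqrt_gram_mat_supp[OF A] by (simp_all add: D_def)
  have "(D - Q) ** N ** (D - Q) = D ** N ** D - (D - Q) - D"
  proof -
    have "D ** N ** Q = D"
      by (simp add: matrix_mul_assoc[symmetric] NQ Jid_mult_right[OF D(3)])
    moreover have "Q ** N ** D = D" "Q ** N ** Q = Q"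
      by (simp_all add: NQ Jid_mult_left[OF D(3)] Jid_mult_left[OF Q(1)])
    ultimately show ?thesis
      by (simp add: matrix_mult_diff_left matrix_mult_diff_right)
  qed
  moreover have "0 \<le> trace (transpose (D - Q) ** N ** (D - Q))"
    using N by (rule trace_congruence_nonneg)
  ultimately have "0 \<le> trace (D ** N ** D) - (trace D - trace Q) - trace D"
    by (simp only: transpose_diff D(1) Q(2) trace_sub)
  moreover have "trace (D ** N ** D) = trace (N ** (transpose A ** A))"
    by (metis D(2) matrix_mul_assoc trace_mul_sym)
  ultimately show ?thesis by (simp add: nuc_def D_def)
qed

text \<open>A one-sided second-order expansion standing in for differentiability of the nuclear
  norm: the quadratic majorant touches it at \<open>R\<close>, and its value at
  \<open>R - t C\<close> is an explicit polynomial in \<open>t\<close>.\<close>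

lemma nuc_perturbation_le:
  fixes R C :: "real^'p^'n"
  assumes R: "R \<in> mat_supp UNIV J" and C: "C \<in> mat_supp UNIV J"
    and inv: "Jinvertible J (psd_sqrt (transpose R ** R))"
  defines "N \<equiv> Jinv J (psd_sqrt (transpose R ** R))"
  shows "nuc (R - t *\<^sub>R C) \<le> nuc R - t * trace (N ** transpose R ** C)
      + t\<^sup>2 * (trace (N ** (transpose C ** C)) / 2)"
proof -
  define Q where "Q = psd_sqrt (transpose R ** R)"
  have Q: "transpose Q = Q" "\<And>x. 0 \<le> x \<bullet> (Q *v x)" "Q ** Q = transpose R ** R" "Q \<in> mat_supp J J"
    using psd_sqrt_gram(1,3)[of R] psd_sqrt_gram(2)[of _ R] psd_sqrt_gram_mat_supp[OF R] by (simp_all add: Q_def)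
  note inv' = inv[folded Q_def]
  have N: "N \<in> mat_supp J J" "N ** Q = Jid J" "Q ** N = Jid J"
    using Jinv_props[OF inv'] by (simp_all add: N_def Q_def)
  have Nsym: "transpose N = N" and Npsd: "\<And>x. 0 \<le> x \<bullet> (N *v x)"
    using Jinv_symmetric_psd[OF Q(1,2) inv'] by (simp_all add: N_def Q_def)
  let ?A = "R - t *\<^sub>R C"
  have "2 * nuc ?A \<le> trace (N ** (transpose ?A ** ?A)) + trace Q"
    using R C by (intro nuc_le_quadratic_majorant[OF _ Q(4,1) Npsd N(2,3)] mat_supp_diff mat_supp_scaleR)
  also have "N ** (transpose ?A ** ?A) = N ** (transpose R ** R) - t *\<^sub>R (N ** (transpose R ** C))
      - t *\<^sub>R (N ** (transpose C ** R)) + t\<^sup>2 *\<^sub>R (N ** (transpose C ** C))"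
    by (simp add: transpose_diff transpose_scalar matrix_mult_diff_left matrix_mult_diff_right
        matrix_mult_scaleR_left matrix_mult_scaleR_right power2_eq_square scaleR_diff_right)
  also have "N ** (transpose R ** R) = Q"
    by (simp add: Q(3)[symmetric] matrix_mul_assoc N(2) Jid_mult_left[OF Q(4)])
  also have "trace (Q - t *\<^sub>R (N ** (transpose R ** C))
      - t *\<^sub>R (N ** (transpose C ** R)) + t\<^sup>2 *\<^sub>R (N ** (transpose C ** C)))
      = trace Q - t * trace (N ** (transpose R ** C)) - t * trace (N ** (transpose C ** R))
        + t\<^sup>2 * trace (N ** (transpose C ** C))"
    by (simp add: trace_add trace_sub trace_scaleR)
  \<comment> \<open>The two cross terms are transposes of each other up to a cyclic shift, so they
    add up.\<close>
  also have "trace (N ** (transpose C ** R)) = trace (N ** (transpose R ** C))"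
  proof -
    have "trace (N ** (transpose C ** R)) = trace (transpose (N ** (transpose C ** R)))"
      by (simp only: trace_transpose)
    also have "\<dots> = trace ((transpose R ** C) ** N)"
      by (simp add: matrix_transpose_mul Nsym)
    also have "\<dots> = trace (N ** (transpose R ** C))" by (rule trace_mul_sym)
    finally show ?thesis .
  qed
  finally show ?thesis
    by (simp add: nuc_def Q_def[symmetric] matrix_mul_assoc field_simps)
qed

lemma nuc_zero: "nuc (0::real^'p^'n) = 0"
proof -
  have "psd_sqrt (transpose (0::real^'p^'n) ** (0::real^'p^'n)) = 0"
    by (rule psd_sqrt_eqI) (auto simp: transpose_def matrix_matrix_mult_def vec_eq_iff)
  then show ?thesis by (simp add: nuc_def trace_def)
qed

section \<open>The gauge norm\<close>

text \<open>Stated for an arbitrary set, so that sublinearity is derived from convexity and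
  absorption, apart from how \<open>Bg\<close> is built.\<close>

definition minkowski_gauge :: "'a::real_vector set \<Rightarrow> 'a \<Rightarrow> real" where
  "minkowski_gauge K x = Inf {t. 0 < t \<and> x \<in> (\<lambda>y. t *\<^sub>R y) ` K}"

lemma gauge_g_eq: "gauge_g Om OmC J = minkowski_gauge (Bg Om OmC J)"
  by (simp add: fun_eq_iff gauge_g_def minkowski_gauge_def)

lemma minkowski_gauge_le:
  assumes "0 < t" "x \<in> (\<lambda>y. t *\<^sub>R y) ` K"
  shows "minkowski_gauge K x \<le> t"
  unfolding minkowski_gauge_def
  using assms by (intro cInf_lower) (auto intro!: bdd_belowI[of _ 0])

text \<open>Absorption gives the infimum its meaning: over an empty set of reals it would carry no
  information.\<close>

lemma minkowski_gauge_approx: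
  assumes "\<exists>t>0. x \<in> (\<lambda>y. t *\<^sub>R y) ` K" and "minkowski_gauge K x < u"
  obtains t where "0 < t" "x \<in> (\<lambda>y. t *\<^sub>R y) ` K" "t < u"
  using cInf_lessD[of "{t. 0 < t \<and> x \<in> (\<lambda>y. t *\<^sub>R y) ` K}" u] assms
  unfolding minkowski_gauge_def by blast

text \<open>If \<open>x\<close> lies in \<open>s K\<close> and \<open>y\<close> in
  \<open>t K\<close>, convexity with weights \<open>s / (s + t)\<close> and
  \<open>t / (s + t)\<close> puts \<open>x + y\<close> into \<open>(s + t) K\<close>.\<close>

lemma minkowski_gauge_triangle:
  assumes conv: "convex K" and abs: "\<And>x. \<exists>t>0. x \<in> (\<lambda>y. t *\<^sub>R y) ` K"
  shows "minkowski_gauge K (x + y) \<le> minkowski_gauge K x + minkowski_gauge K y"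
proof (rule field_le_epsilon)
  fix e :: real assume e: "e > 0"
  obtain s where s: "0 < s" "x \<in> (\<lambda>y. s *\<^sub>R y) ` K" "s < minkowski_gauge K x + e / 2"
    using minkowski_gauge_approx[OF abs, of x "minkowski_gauge K x + e / 2"] e by auto
  obtain t where t: "0 < t" "y \<in> (\<lambda>y. t *\<^sub>R y) ` K" "t < minkowski_gauge K y + e / 2"
    using minkowski_gauge_approx[OF abs, of y "minkowski_gauge K y + e / 2"] e by auto
  from s t obtain a b where ab: "a \<in> K" "x = s *\<^sub>R a" "b \<in> K" "y = t *\<^sub>R b" by blast
  have "(s / (s + t)) *\<^sub>R a + (t / (s + t)) *\<^sub>R b \<in> K"
    using conv ab s t by (intro convexD) (auto simp: add_divide_distrib[symmetric])
  moreover have "x + y = (s + t) *\<^sub>R ((s / (s + t)) *\<^sub>R a + (t / (s + t)) *\<^sub>R b)"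
    using s t by (simp add: ab scaleR_add_right)
  ultimately have "minkowski_gauge K (x + y) \<le> s + t"
    using s t by (intro minkowski_gauge_le) auto
  then show "minkowski_gauge K (x + y) \<le> minkowski_gauge K x + minkowski_gauge K y + e"
    using s t by simp
qed

lemma minkowski_gauge_scaleR_le:
  assumes abs: "\<exists>t>0. x \<in> (\<lambda>y. t *\<^sub>R y) ` K" and c: "0 < c"
  shows "minkowski_gauge K (c *\<^sub>R x) \<le> c * minkowski_gauge K x"
proof (rule field_le_epsilon)
  fix e :: real assume e: "e > 0"
  obtain s where s: "0 < s" "x \<in> (\<lambda>y. s *\<^sub>R y) ` K" "s < minkowski_gauge K x + e / c"
    using minkowski_gauge_approx[OF abs, of "minkowski_gauge K x + e / c"] e c by auto
  then have "minkowski_gauge K (c *\<^sub>R x) \<le> c * s"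
    using c by (intro minkowski_gauge_le) auto
  also have "\<dots> \<le> c * minkowski_gauge K x + e"
    using s(3) c by (simp add: field_simps)
  finally show "minkowski_gauge K (c *\<^sub>R x) \<le> c * minkowski_gauge K x + e" .
qed

lemma minkowski_gauge_minus:
  assumes "\<And>x. x \<in> K \<Longrightarrow> - x \<in> K"
  shows "minkowski_gauge K (- x) = minkowski_gauge K x"
proof -
  have "- x \<in> (\<lambda>y. t *\<^sub>R y) ` K \<longleftrightarrow> x \<in> (\<lambda>y. t *\<^sub>R y) ` K" for t
    using assms by (metis (no_types, opaque_lifting) image_iff scaleR_minus_right minus_minus)
  then show ?thesis by (simp add: minkowski_gauge_def)
qed

lemma restr_scaleR: "restr S (c *\<^sub>R x) = c *\<^sub>R restr S x"
  by (simp add: restr_def vec_eq_iff)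

lemma restr_diff: "restr S (x - y) = restr S x - restr S y"
  by (simp add: restr_def vec_eq_iff)

lemma restr_in_supp_on: "restr S x \<in> supp_on S"
  by (simp add: restr_def supp_on_def)

lemma flip_minus: "flip J (- x) = - flip J x"
  by (simp add: flip_def restr_def vec_eq_iff)

section \<open>The gauge generated by the weakly decomposable lower bounds of
  \<open>Om\<close>\<close>

context
  fixes Om :: "real^'p \<Rightarrow> real" and OmC :: "'p set \<Rightarrow> real^'p \<Rightarrow> real"
  assumes Om: "is_norm Om"
    and OmC: "\<And>S. allowed Om S \<Longrightarrow> norm_on (supp_on (- S)) (OmC S)"
begin

lemma Upsilon_scaleR:
  assumes "allowed Om S"
  shows "Upsilon Om OmC S (c *\<^sub>R x) = \<bar>c\<bar> * Upsilon Om OmC S x"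
proof -
  have "Om (c *\<^sub>R restr S x) = \<bar>c\<bar> * Om (restr S x)"
    using Om by (simp add: is_norm_def norm_on_def)
  moreover have "OmC S (c *\<^sub>R restr (- S) x) = \<bar>c\<bar> * OmC S (restr (- S) x)"
    using OmC[OF assms] restr_in_supp_on[of "- S" x] by (simp add: norm_on_def)
  ultimately show ?thesis
    by (simp add: Upsilon_def restr_scaleR distrib_left)
qed

lemma Upsilon_nonneg:
  assumes "allowed Om S"
  shows "0 \<le> Upsilon Om OmC S x"
  using Om OmC[OF assms] restr_in_supp_on[of "- S" x]
  by (simp add: Upsilon_def is_norm_def norm_on_def)

lemma Bbar_minus: "x \<in> Bbar Om OmC \<Longrightarrow> - x \<in> Bbar Om OmC"
  using Upsilon_scaleR[of _ "-1" x] by (auto simp: Bbar_def)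

lemma Bbar_scaleR_inverse:
  assumes "allowed Om S" "Upsilon Om OmC S x \<le> t" "0 < t"
  shows "(1 / t) *\<^sub>R x \<in> Bbar Om OmC"
proof -
  have "Upsilon Om OmC S ((1 / t) *\<^sub>R x) \<le> 1"
    using assms by (simp add: Upsilon_scaleR)
  then show ?thesis using assms(1) unfolding Bbar_def by blast
qed

text \<open>Negation is linear, so it commutes with the convex hull, and the generating set is
  symmetric because each \<open>Upsilon\<close> of an allowed set is even.\<close>

lemma Bg_minus:
  assumes "x \<in> Bg Om OmC J"
  shows "- x \<in> Bg Om OmC J"
proof -
  let ?U = "Bbar Om OmC \<union> flip J ` Bbar Om OmC"
  have "uminus ` ?U \<subseteq> ?U"
  proof
    fix y assume "y \<in> uminus ` ?U"
    then obtain z where z: "z \<in> ?U" "y = - z" by blast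
    then show "y \<in> ?U" using Bbar_minus by (auto simp: flip_minus[symmetric])
  qed
  then have "convex hull (uminus ` ?U) \<subseteq> convex hull ?U" by (rule hull_mono)
  moreover have "convex hull (uminus ` ?U) = uminus ` (convex hull ?U)"
    by (rule convex_hull_linear_image[symmetric]) (simp add: linear_iff)
  ultimately show ?thesis using assms by (auto simp: Bg_def)
qed

context
  fixes S :: "'p set"
  assumes S: "allowed Om S"
begin

text \<open>A single allowed set makes \<open>Bg\<close> absorbing: every vector can be scaled into
  the unit ball of its \<open>Upsilon\<close>. The added 1 keeps the scale positive even at
  \<open>x = 0\<close>.\<close>

lemma Bg_absorbing: "\<exists>t>0. x \<in> (\<lambda>y. t *\<^sub>R y) ` Bg Om OmC J"
proof -
  let ?t = "Upsilon Om OmC S x + 1"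
  have t: "?t > 0" using Upsilon_nonneg[OF S, of x] by simp
  then have "(1 / ?t) *\<^sub>R x \<in> Bbar Om OmC"
    by (intro Bbar_scaleR_inverse[OF S]) auto
  then have "(1 / ?t) *\<^sub>R x \<in> Bg Om OmC J"
    unfolding Bg_def by (intro hull_inc) auto
  moreover have "x = ?t *\<^sub>R ((1 / ?t) *\<^sub>R x)" using t by simp
  ultimately show ?thesis using t by blast
qed

lemma gauge_g_triangle: "gauge_g Om OmC J (x + y) \<le> gauge_g Om OmC J x + gauge_g Om OmC J y"
  unfolding gauge_g_eq by (intro minkowski_gauge_triangle Bg_absorbing) (simp add: Bg_def)

lemma gauge_g_scaleR_le: "0 < c \<Longrightarrow> gauge_g Om OmC J (c *\<^sub>R x) \<le> c * gauge_g Om OmC J x"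
  unfolding gauge_g_eq by (intro minkowski_gauge_scaleR_le Bg_absorbing)

lemma gauge_g_minus: "gauge_g Om OmC J (- x) = gauge_g Om OmC J x"
  unfolding gauge_g_eq by (intro minkowski_gauge_minus Bg_minus)

lemma gauge_g_nonneg: "0 \<le> gauge_g Om OmC J x"
  unfolding gauge_g_def using Bg_absorbing[of x J] by (intro cInf_greatest) auto

text \<open>The flip is what makes this work: \<open>\<beta>\<^bsub>J\<^sup>c\<^esub>\<close> is the midpoint of \<open>\<beta>\<close> and the flip of \<open>- \<beta>\<close>.\<close>
lemma gauge_g_restr_le_Upsilon: "gauge_g Om OmC J (restr (- J) x) \<le> Upsilon Om OmC S x"
proof (rule field_le_epsilon)
  fix e :: real assume e: "e > 0"
  define t where "t = Upsilon Om OmC S x + e"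
  have t: "t > 0" using Upsilon_nonneg[OF S, of x] e by (simp add: t_def)
  define y where "y = (1 / t) *\<^sub>R x"
  have y: "y \<in> Bbar Om OmC"
    unfolding y_def using t e by (intro Bbar_scaleR_inverse[OF S]) (auto simp: t_def)
  have "(1/2) *\<^sub>R y + (1/2) *\<^sub>R flip J (- y) \<in> Bg Om OmC J"
  proof (rule convexD)
    show "convex (Bg Om OmC J)" by (simp add: Bg_def)
    show "y \<in> Bg Om OmC J" "flip J (- y) \<in> Bg Om OmC J"
      unfolding Bg_def using y Bbar_minus[OF y] by (auto intro: hull_inc)
  qed auto
  moreover have "restr (- J) x = t *\<^sub>R ((1/2) *\<^sub>R y + (1/2) *\<^sub>R flip J (- y))"
    using t by (simp add: y_def flip_def restr_def vec_eq_iff field_simps)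
  ultimately have "gauge_g Om OmC J (restr (- J) x) \<le> t"
    unfolding gauge_g_eq using t by (intro minkowski_gauge_le) auto
  then show "gauge_g Om OmC J (restr (- J) x) \<le> Upsilon Om OmC S x + e"
    by (simp add: t_def)
qed

text \<open>Only the summand of column \<open>j\<close> changes, and sublinearity of the gauge
  controls its increase.\<close>

lemma Psi_add_single_column_le:
  assumes j: "j \<in> J" and d: "d \<in> supp_on (- J)" and t: "0 < t"
  shows "Psi Om OmC J (B + t *\<^sub>R (\<chi> k l. if l = j then d $ k else 0))
      \<le> Psi Om OmC J B + t * gauge_g Om OmC J d"
proof -
  let ?B' = "B + t *\<^sub>R (\<chi> k l. if l = j then d $ k else 0)"
  have "Psi Om OmC J ?B' = gauge_g Om OmC J (col_on J ?B' j) + (\<Sum>l\<in>J - {j}. gauge_g Om OmC J (col_on J ?B' l))"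
    unfolding Psi_def using j by (simp add: sum.remove)
  also have "(\<Sum>l\<in>J - {j}. gauge_g Om OmC J (col_on J ?B' l)) = (\<Sum>l\<in>J - {j}. gauge_g Om OmC J (col_on J B l))"
    by (intro sum.cong refl arg_cong[of _ _ "gauge_g Om OmC J"]) (auto simp: col_on_def vec_eq_iff)
  also have "col_on J ?B' j = col_on J B j + t *\<^sub>R d"
    using d by (auto simp: col_on_def vec_eq_iff supp_on_def)
  also have "gauge_g Om OmC J (col_on J B j + t *\<^sub>R d) \<le> gauge_g Om OmC J (col_on J B j) + t * gauge_g Om OmC J d"
    using gauge_g_triangle[of J "col_on J B j" "t *\<^sub>R d"] gauge_g_scaleR_le[OF t, of J d] by simp
  finally show ?thesis
    unfolding Psi_def using j by (simp add: sum.remove)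
qed

end

end

section \<open>Rotation invariance of Gaussian vectors\<close>

lemma nn_integral_lborel_translate:
  fixes g :: "'a::euclidean_space \<Rightarrow> ennreal"
  assumes [measurable]: "g \<in> borel_measurable borel"
  shows "(\<integral>\<^sup>+x. g (c + x) \<partial>lborel) = (\<integral>\<^sup>+x. g x \<partial>lborel)"
proof -
  have "(\<integral>\<^sup>+x. g x \<partial>lborel) = (\<integral>\<^sup>+x. g x \<partial>distr lborel borel ((+) c))"
    by (simp add: lborel_distr_plus)
  also have "\<dots> = (\<integral>\<^sup>+x. g (c + x) \<partial>lborel)"
    by (subst nn_integral_distr) auto
  finally show ?thesis by simp
qed

text \<open>The uniqueness argument for Haar measure: with \<open>h\<close> the indicator of the unit ball, which is
  invariant under \<open>f\<close>, evaluate the double integral of \<open>g (f x + y) * h y\<close> in both orders.\<close>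
lemma nn_integral_lborel_orthogonal_transformation:
  fixes f :: "'a::euclidean_space \<Rightarrow> 'a" and g :: "'a \<Rightarrow> ennreal"
  assumes f: "orthogonal_transformation f" and [measurable]: "g \<in> borel_measurable borel"
  shows "(\<integral>\<^sup>+x. g (f x) \<partial>lborel) = (\<integral>\<^sup>+x. g x \<partial>lborel)"
proof -
  have lin: "linear f" using f by (rule orthogonal_transformation_linear)
  have [measurable]: "f \<in> borel_measurable borel"
    using lin by (intro borel_measurable_continuous_onI linear_continuous_on) (simp add: linear_conv_bounded_linear)
  define h :: "'a \<Rightarrow> ennreal" where "h = indicator (ball 0 1)"
  have [measurable]: "h \<in> borel_measurable borel" unfolding h_def by (intro borel_measurable_indicator) simp
  have hf: "h (f x) = h x" and hm: "h (- x) = h x" for x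
    using orthogonal_transformation_norm[OF f] by (simp_all add: h_def indicator_def)
  define k where "k = (\<integral>\<^sup>+y. h y \<partial>lborel)"
  have k: "k = emeasure lborel (ball (0::'a) 1)" by (simp add: k_def h_def)
  have k0: "k \<noteq> 0" and ki: "k \<noteq> \<top>"
  proof -
    have "emeasure lborel (ball (0::'a) 1) \<noteq> 0"
    proof
      assume "emeasure lborel (ball (0::'a) 1) = 0"
      then have "ball (0::'a) 1 \<in> null_sets lborel" by (simp add: null_sets_def)
      then have "negligible (ball (0::'a) 1)"
        unfolding negligible_iff_null_sets by (rule null_sets_completionI)
      then show False using open_not_negligible[of "ball (0::'a) 1"] by simp
    qed
    then show "k \<noteq> 0" by (simp add: k)
    show "k \<noteq> \<top>" using emeasure_bounded_finite[OF bounded_ball, of "0::'a" 1] by (simp add: k less_top)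
  qed
  \<comment> \<open>With \<open>y = f z\<close> the argument becomes \<open>f (z - x)\<close>;
    invariance and evenness of \<open>h\<close> turn the integrand into a translate of
    \<open>h\<close>, so the integral does not depend on \<open>y\<close>.\<close>
  have shift: "(\<integral>\<^sup>+x. h (y - f x) \<partial>lborel) = k" for y
  proof -
    obtain z where z: "y = f z"
      using orthogonal_transformation_surj[OF f] by blast
    have "(\<integral>\<^sup>+x. h (y - f x) \<partial>lborel) = (\<integral>\<^sup>+x. h (- z + x) \<partial>lborel)"
      using hf hm by (intro nn_integral_cong) (metis add.commute linear_diff[OF lin] minus_diff_eq uminus_add_conv_diff z)
    also have "\<dots> = k" unfolding k_def by (rule nn_integral_lborel_translate) measurable
    finally show ?thesis .
  qed
  have "(\<integral>\<^sup>+x. g (f x) \<partial>lborel) * k = (\<integral>\<^sup>+y. (\<integral>\<^sup>+x. g (f x) \<partial>lborel) * h y \<partial>lborel)"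
    unfolding k_def by (rule nn_integral_cmult[symmetric]) measurable
  \<comment> \<open>Translation by the preimage \<open>z\<close> of \<open>y\<close> leaves the
    integral of \<open>g \<circ> f\<close> unchanged and produces \<open>f x + y\<close>.\<close>
  also have "\<dots> = (\<integral>\<^sup>+y. (\<integral>\<^sup>+x. g (f x + y) * h y \<partial>lborel) \<partial>lborel)"
  proof (rule nn_integral_cong)
    fix y :: 'a
    obtain z where z: "y = f z"
      using orthogonal_transformation_surj[OF f] by blast
    have "(\<integral>\<^sup>+x. g (f x) \<partial>lborel) = (\<integral>\<^sup>+x. g (f (z + x)) \<partial>lborel)"
      by (rule nn_integral_lborel_translate[symmetric]) measurable
    also have "\<dots> = (\<integral>\<^sup>+x. g (f x + y) \<partial>lborel)"
      by (simp add: linear_add[OF lin] z add.commute)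
    finally show "(\<integral>\<^sup>+x. g (f x) \<partial>lborel) * h y = (\<integral>\<^sup>+x. g (f x + y) * h y \<partial>lborel)"
      by (simp add: nn_integral_multc)
  qed
  also have "\<dots> = (\<integral>\<^sup>+x. (\<integral>\<^sup>+y. g (f x + y) * h y \<partial>lborel) \<partial>lborel)"
    by (rule lborel_pair.Fubini') measurable
  also have "\<dots> = (\<integral>\<^sup>+x. (\<integral>\<^sup>+y. g y * h (y - f x) \<partial>lborel) \<partial>lborel)"
  proof (rule nn_integral_cong)
    fix x :: 'a
    show "(\<integral>\<^sup>+y. g (f x + y) * h y \<partial>lborel) = (\<integral>\<^sup>+y. g y * h (y - f x) \<partial>lborel)"
      using nn_integral_lborel_translate[of "\<lambda>y. g y * h (y - f x)" "f x"] by simp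
  qed
  also have "\<dots> = (\<integral>\<^sup>+y. (\<integral>\<^sup>+x. g y * h (y - f x) \<partial>lborel) \<partial>lborel)"
    by (rule lborel_pair.Fubini') measurable
  also have "\<dots> = (\<integral>\<^sup>+y. g y * k \<partial>lborel)"
    by (simp add: nn_integral_cmult shift)
  also have "\<dots> = (\<integral>\<^sup>+y. g y \<partial>lborel) * k"
    by (rule nn_integral_multc) measurable
  finally show ?thesis
    using k0 ki by (metis mult_divide_eq_ennreal)
qed

text \<open>Since \<open>\<phi> x\<close> may be written as \<open>\<phi> (f x)\<close>, the mass of
  a preimage is the integral of a function of \<open>f x\<close>, to which invariance of Lebesgue
  measure applies.\<close>

lemma density_orthogonal_transformation_invariant:
  fixes f :: "'a::euclidean_space \<Rightarrow> 'a" and \<phi> :: "'a \<Rightarrow> ennreal"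
  assumes f: "orthogonal_transformation f" and [measurable]: "\<phi> \<in> borel_measurable borel"
    and inv: "\<And>x. \<phi> (f x) = \<phi> x"
  shows "distr (density lborel \<phi>) borel f = density lborel \<phi>"
proof (rule measure_eqI)
  have lin: "linear f" using f by (rule orthogonal_transformation_linear)
  have [measurable]: "f \<in> borel_measurable borel"
    using lin by (intro borel_measurable_continuous_onI linear_continuous_on) (simp add: linear_conv_bounded_linear)
  fix A assume "A \<in> sets (distr (density lborel \<phi>) borel f)"
  then have A [measurable]: "A \<in> sets borel" by simp
  have "emeasure (distr (density lborel \<phi>) borel f) A = emeasure (density lborel \<phi>) (f -` A)"
    by (subst emeasure_distr) auto
  also have "\<dots> = (\<integral>\<^sup>+x. \<phi> x * indicator (f -` A) x \<partial>lborel)"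
    by (rule emeasure_density) (auto intro!: measurable_sets_borel[of f borel])
  also have "\<dots> = (\<integral>\<^sup>+x. \<phi> (f x) * indicator A (f x) \<partial>lborel)"
    by (simp add: inv indicator_def)
  also have "\<dots> = (\<integral>\<^sup>+x. \<phi> x * indicator A x \<partial>lborel)"
    by (rule nn_integral_lborel_orthogonal_transformation[OF f]) measurable
  also have "\<dots> = emeasure (density lborel \<phi>) A"
    by (rule emeasure_density[symmetric]) auto
  finally show "emeasure (distr (density lborel \<phi>) borel f) A = emeasure (density lborel \<phi>) A" .
qed simp

section \<open>Joint density of a Gaussian vector with independent coordinates\<close>

text \<open>A product measure is determined by its values on rectangles; there the indicator factors
  over the coordinates, and so does the integral.\<close>

lemma PiM_density:
  fixes f :: "'i \<Rightarrow> 'a \<Rightarrow> ennreal"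
  assumes I: "finite I" and M: "\<And>i. sigma_finite_measure (M i)"
    and D: "\<And>i. sigma_finite_measure (density (M i) (f i))"
    and f [measurable]: "\<And>i. f i \<in> borel_measurable (M i)"
  shows "(\<Pi>\<^sub>M i\<in>I. density (M i) (f i)) = density (\<Pi>\<^sub>M i\<in>I. M i) (\<lambda>x. \<Prod>i\<in>I. f i (x i))"
proof -
  interpret M: product_sigma_finite M using M by (simp add: product_sigma_finite_def)
  interpret D: product_sigma_finite "\<lambda>i. density (M i) (f i)" using D by (simp add: product_sigma_finite_def)
  show ?thesis
  proof (rule D.PiM_eqI[OF I, symmetric])
    show "sets (density (Pi\<^sub>M I M) (\<lambda>x. \<Prod>i\<in>I. f i (x i))) = sets (Pi\<^sub>M I (\<lambda>i. density (M i) (f i)))"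
      by (simp add: cong: sets_PiM_cong)
    fix A assume A: "\<And>i. i \<in> I \<Longrightarrow> A i \<in> sets (density (M i) (f i))"
    then have A' [measurable]: "A i \<in> sets (M i)" if "i \<in> I" for i using that by simp
    have PA: "Pi\<^sub>E I A \<in> sets (Pi\<^sub>M I M)" using I A' by (intro sets_PiM_I_finite)
    have "emeasure (density (Pi\<^sub>M I M) (\<lambda>x. \<Prod>i\<in>I. f i (x i))) (Pi\<^sub>E I A)
        = (\<integral>\<^sup>+x. (\<Prod>i\<in>I. f i (x i)) * indicator (Pi\<^sub>E I A) x \<partial>Pi\<^sub>M I M)"
      using PA by (subst emeasure_density) auto
    also have "\<dots> = (\<integral>\<^sup>+x. (\<Prod>i\<in>I. f i (x i) * indicator (A i) (x i)) \<partial>Pi\<^sub>M I M)"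
    proof (rule nn_integral_cong)
      fix x assume x: "x \<in> space (Pi\<^sub>M I M)"
      have "indicator (Pi\<^sub>E I A) x = (\<Prod>i\<in>I. indicator (A i) (x i) :: ennreal)"
      proof (cases "x \<in> Pi\<^sub>E I A")
        case True
        then show ?thesis by (auto simp: PiE_def Pi_def indicator_def)
      next
        case False
        then obtain i where "i \<in> I" "x i \<notin> A i"
          using x by (auto simp: space_PiM PiE_def Pi_def)
        then show ?thesis
          using False I by (auto simp: indicator_def prod_zero_iff)
      qed
      then show "(\<Prod>i\<in>I. f i (x i)) * indicator (Pi\<^sub>E I A) x
          = (\<Prod>i\<in>I. f i (x i) * indicator (A i) (x i))"
        by (simp add: prod.distrib)
    qed
    also have "\<dots> = (\<Prod>i\<in>I. \<integral>\<^sup>+x. f i x * indicator (A i) x \<partial>M i)"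
      by (rule M.product_nn_integral_prod[OF I]) measurable
    also have "\<dots> = (\<Prod>i\<in>I. emeasure (density (M i) (f i)) (A i))"
      by (intro prod.cong refl emeasure_density[symmetric]) auto
    finally show "emeasure (density (Pi\<^sub>M I M) (\<lambda>x. \<Prod>i\<in>I. f i (x i))) (Pi\<^sub>E I A)
        = (\<Prod>i\<in>I. emeasure (density (M i) (f i)) (A i))" .
  qed
qed

lemma Basis_real_vec_eq: "(Basis :: (real^'n) set) = range (\<lambda>i. axis i 1)"
  by (auto simp: Basis_vec_def)

lemma measurable_vec_lambda_PiM:
  "(\<lambda>f. \<chi> i. f i) \<in> borel_measurable (\<Pi>\<^sub>M i\<in>(UNIV::'n::finite set). (lborel :: real measure))"
  by (subst borel_measurable_euclidean_space) (auto simp: Basis_real_vec_eq inner_axis)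

lemma borel_measurable_vec_nth: "(\<lambda>x. (x::real^'n) $ i) \<in> borel_measurable borel"
  by (intro borel_measurable_continuous_onI continuous_intros)

text \<open>Lebesgue measure is determined by the volumes of boxes. The identity carries product
  densities on functions over to vectors.\<close>

lemma lborel_vec_eq:
  "(lborel :: (real^'n) measure) = distr (\<Pi>\<^sub>M i\<in>(UNIV::'n set). lborel) borel (\<lambda>f. \<chi> i. f i)"
proof (rule lborel_eqI)
  interpret product_sigma_finite "\<lambda>_::'n. lborel :: real measure" by standard
  fix l u :: "real^'n" assume le: "\<And>b. b \<in> Basis \<Longrightarrow> l \<bullet> b \<le> u \<bullet> b"
  have le': "l $ i \<le> u $ i" for i
    using le[of "axis i 1"] by (simp add: inner_axis)
  have "emeasure (distr (\<Pi>\<^sub>M i\<in>(UNIV::'n set). lborel) borel (\<lambda>f. \<chi> i. f i)) (box l u)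
      = emeasure (\<Pi>\<^sub>M i\<in>(UNIV::'n set). lborel) (\<Pi>\<^sub>E i\<in>UNIV. {l $ i <..< u $ i})"
    by (subst emeasure_distr)
      (auto simp: measurable_vec_lambda_PiM space_PiM interval_cart(1) PiE_def Pi_def
        intro!: arg_cong2[where f=emeasure])
  also have "\<dots> = (\<Prod>i\<in>UNIV. emeasure lborel {l $ i <..< u $ i})"
    by (rule emeasure_PiM) auto
  also have "\<dots> = ennreal (\<Prod>i\<in>UNIV. (u - l) $ i)"
    using le' by (simp add: prod_ennreal)
  also have "(\<Prod>i\<in>UNIV. (u - l) $ i) = (\<Prod>b\<in>Basis. (u - l) \<bullet> b)"
    unfolding Basis_real_vec_eq
    by (subst prod.reindex) (auto intro: inj_onI simp: axis_eq_axis inner_axis)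
  finally show "emeasure (distr (\<Pi>\<^sub>M i\<in>(UNIV::'n set). lborel) borel (\<lambda>f. \<chi> i. f i)) (box l u)
      = ennreal (\<Prod>b\<in>Basis. (u - l) \<bullet> b)" .
qed simp

text \<open>The singletons \<open>{h j}\<close> are pairwise disjoint by injectivity, so this is an
  instance of independence of disjoint blocks.\<close>

lemma (in prob_space) indep_vars_reindex:
  assumes ind: "indep_vars M' X I" and h: "inj_on h J" "h ` J \<subseteq> I"
  shows "indep_vars (\<lambda>j. M' (h j)) (\<lambda>j. X (h j)) J"
proof -
  have "indep_vars (\<lambda>j. Pi\<^sub>M {h j} M') (\<lambda>j \<omega>. restrict (\<lambda>i. X i \<omega>) {h j}) J"
    using h by (intro indep_vars_restrict[OF ind]) (auto simp: disjoint_family_on_def inj_on_def)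
  then have "indep_vars (\<lambda>j. M' (h j)) (\<lambda>j \<omega>. (\<lambda>f. f (h j)) (restrict (\<lambda>i. X i \<omega>) {h j})) J"
    by (rule indep_vars_compose2) auto
  then show ?thesis by simp
qed

text \<open>Independence makes the law of the coordinate family a product of normal laws, whose
  density is then pushed forward from functions to vectors.\<close>

lemma (in prob_space) distr_indep_normal_vector:
  fixes Z :: "'a \<Rightarrow> real^'n"
  assumes indep: "indep_vars (\<lambda>_. borel) (\<lambda>i \<omega>. Z \<omega> $ i) UNIV"
    and dist: "\<And>i. distributed M lborel (\<lambda>\<omega>. Z \<omega> $ i) (normal_density 0 \<sigma>)" and \<sigma>: "0 < \<sigma>"
  shows "distr M borel Z = density lborel (\<lambda>x. \<Prod>i\<in>UNIV. ennreal (normal_density 0 \<sigma> (x $ i)))"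
proof -
  let ?n = "\<lambda>x. ennreal (normal_density 0 \<sigma> x)"
  have rv [measurable]: "(\<lambda>\<omega>. Z \<omega> $ i) \<in> borel_measurable M" for i
    using distributed_measurable[OF dist] by simp
  have marg: "distr M borel (\<lambda>\<omega>. Z \<omega> $ i) = density lborel ?n" for i
    using distributed_distr_eq_density[OF dist[of i]] by (simp cong: distr_cong)
  have sf: "sigma_finite_measure (density lborel ?n)"
    using prob_space_normal_density[OF \<sigma>] prob_space_imp_sigma_finite by blast
  have vec: "(\<lambda>f. \<chi> i. f i) \<in> borel_measurable (\<Pi>\<^sub>M i\<in>(UNIV::'n set). (borel :: real measure))"
    using measurable_vec_lambda_PiM by (simp cong: measurable_cong_sets sets_PiM_cong)
  have "Z = (\<lambda>f. \<chi> i. f i) \<circ> (\<lambda>\<omega>. \<lambda>i\<in>UNIV. Z \<omega> $ i)"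
    by (simp add: fun_eq_iff vec_eq_iff)
  then have "distr M borel Z = distr M borel ((\<lambda>f. \<chi> i. f i) \<circ> (\<lambda>\<omega>. \<lambda>i\<in>UNIV. Z \<omega> $ i))"
    by (rule arg_cong)
  also have "\<dots> = distr (distr M (\<Pi>\<^sub>M i\<in>UNIV. borel) (\<lambda>\<omega>. \<lambda>i\<in>UNIV. Z \<omega> $ i)) borel (\<lambda>f. \<chi> i. f i)"
    by (rule distr_distr[symmetric, OF vec]) measurable
  also have "distr M (\<Pi>\<^sub>M i\<in>UNIV. borel) (\<lambda>\<omega>. \<lambda>i\<in>UNIV. Z \<omega> $ i)
      = (\<Pi>\<^sub>M i\<in>UNIV. distr M borel (\<lambda>\<omega>. Z \<omega> $ i))"
    by (rule indep_vars_iff_distr_eq_PiM[THEN iffD1, OF _ _ indep]) simp_all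
  also have "\<dots> = (\<Pi>\<^sub>M i\<in>UNIV. density lborel ?n)" by (simp add: marg)
  also have "\<dots> = density (\<Pi>\<^sub>M i\<in>UNIV. lborel) (\<lambda>x. \<Prod>i\<in>UNIV. ?n (x i))"
    by (rule PiM_density) (auto intro: sf lborel.sigma_finite_measure_axioms)
  also have "distr (density (\<Pi>\<^sub>M i\<in>(UNIV::'n set). lborel) (\<lambda>x. \<Prod>i\<in>UNIV. ?n (x i))) borel (\<lambda>f. \<chi> i. f i)
      = density lborel (\<lambda>x. \<Prod>i\<in>UNIV. ?n (x $ i))"
  proof -
    have "density (distr (\<Pi>\<^sub>M i\<in>(UNIV::'n set). lborel) borel (\<lambda>f. \<chi> i. f i)) (\<lambda>x. \<Prod>i\<in>UNIV. ?n (x $ i))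
        = distr (density (\<Pi>\<^sub>M i\<in>UNIV. lborel) (\<lambda>x. \<Prod>i\<in>UNIV. ?n ((\<chi> i. x i) $ i))) borel (\<lambda>f. \<chi> i. f i)"
      by (rule density_distr)
        (auto intro!: measurable_vec_lambda_PiM borel_measurable_prod measurable_compose[OF borel_measurable_vec_nth])
    then show ?thesis unfolding lborel_vec_eq[symmetric] vec_lambda_beta by (rule sym)
  qed
  finally show ?thesis .
qed

text \<open>The joint density depends on \<open>x\<close> only through its norm, which is where
  rotation invariance comes from.\<close>

lemma prod_normal_density_eq_norm:
  fixes x :: "real^'n"
  shows "(\<Prod>i\<in>UNIV. ennreal (normal_density 0 \<sigma> (x $ i)))
      = ennreal ((1 / sqrt (2 * pi * \<sigma>\<^sup>2)) ^ CARD('n) * exp (- (norm x)\<^sup>2 / (2 * \<sigma>\<^sup>2)))"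
proof -
  have "(norm x)\<^sup>2 = (\<Sum>i\<in>UNIV. (x $ i)\<^sup>2)"
    unfolding power2_norm_eq_inner inner_vec_def by (simp add: power2_eq_square)
  then have "(\<Prod>i\<in>UNIV. exp (- (x $ i)\<^sup>2 / (2 * \<sigma>\<^sup>2))) = exp (- (norm x)\<^sup>2 / (2 * \<sigma>\<^sup>2))"
    by (simp add: exp_sum[symmetric] sum_divide_distrib[symmetric] sum_negf)
  then show ?thesis
    by (simp add: prod_ennreal normal_density_def prod.distrib power_divide prod_dividef)
qed

section \<open>Orthonormal functionals of a Gaussian vector\<close>

text \<open>The family is completed by an orthonormal basis of its orthogonal complement and the
  union is enumerated by \<open>'n\<close>. As \<open>J\<close> lives in another type,
  \<open>\<iota>\<close> records which coordinate of the orthogonal map carries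
  \<open>a j\<close>.\<close>

lemma orthonormal_family_extension:
  fixes a :: "'j \<Rightarrow> real^'n"
  assumes J: "finite J" and a: "\<And>i k. i \<in> J \<Longrightarrow> k \<in> J \<Longrightarrow> a i \<bullet> a k = (if i = k then 1 else 0)"
  obtains h \<iota> where "orthogonal_transformation (\<lambda>x. \<chi> i::'n. h i \<bullet> x)" "inj_on \<iota> J"
    "\<And>j. j \<in> J \<Longrightarrow> h (\<iota> j) = a j"
proof -
  define V where "V = {x. \<forall>j\<in>J. a j \<bullet> x = 0}"
  have V: "subspace V" by (simp add: V_def subspace_def inner_add_right)
  obtain B1 where B1: "B1 \<subseteq> V" "pairwise orthogonal B1" "\<And>x. x \<in> B1 \<Longrightarrow> norm x = 1" "span B1 = V"
    using orthonormal_basis_subspace[OF V] by metis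
  define B where "B = a ` J \<union> B1"
  have na: "norm (a j) = 1" if "j \<in> J" for j
    using a[OF that that] by (simp add: norm_eq_1)
  have orth: "pairwise orthogonal B"
    using B1(1,2) a unfolding B_def
    by (auto simp: pairwise_def orthogonal_def V_def inner_commute subset_iff)
  have n1: "norm b = 1" if "b \<in> B" for b
    using that B1(3) na by (auto simp: B_def)
  then have "0 \<notin> B" by fastforce
  then have ind: "independent B" using orth by (rule pairwise_orthogonal_independent[rotated])
  then have fin: "finite B" by (rule independent_imp_finite)
  have sp: "span B = UNIV"
  proof -
    have "x \<in> span B" for x
    proof -
      define y where "y = (\<Sum>j\<in>J. (a j \<bullet> x) *\<^sub>R a j)"
      have "y \<in> span B" unfolding y_def B_def by (intro span_sum span_scale span_base) auto
      moreover have "x - y \<in> V"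
      proof -
        have "a j \<bullet> y = a j \<bullet> x" if "j \<in> J" for j
        proof -
          have "a j \<bullet> y = (\<Sum>k\<in>J. if j = k then a k \<bullet> x else 0)"
            unfolding y_def inner_sum_right using a that by (intro sum.cong) auto
          then show ?thesis using that J by simp
        qed
        then show ?thesis by (simp add: V_def inner_diff_right)
      qed
      then have "x - y \<in> span B" using B1(4) span_mono[of B1 B] by (auto simp: B_def)
      ultimately have "y + (x - y) \<in> span B" by (rule span_add)
      then show ?thesis by simp
    qed
    then show ?thesis by blast
  qed
  have "card B = CARD('n)"
    using dim_eq_card_independent[OF ind] sp by (metis dim_UNIV dim_span DIM_cart DIM_real mult.right_neutral)
  then obtain h :: "'n \<Rightarrow> real^'n" where h: "bij_betw h UNIV B"
    using fin finite_same_card_bij[of "UNIV::'n set" B] by auto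
  define \<iota> where "\<iota> = (\<lambda>j. inv h (a j))"
  have h\<iota>: "h (\<iota> j) = a j" if "j \<in> J" for j
    unfolding \<iota>_def using h that by (intro f_inv_into_f) (auto simp: bij_betw_def B_def)
  have "inj_on \<iota> J"
  proof (rule inj_onI)
    fix i j assume ij: "i \<in> J" "j \<in> J" "\<iota> i = \<iota> j"
    then have "a i = a j" using h\<iota> by metis
    then show "i = j" using a[OF ij(1,2)] a[OF ij(1,1)] by (auto split: if_splits)
  qed
  moreover have "orthogonal_transformation (\<lambda>x. \<chi> i::'n. h i \<bullet> x)"
    unfolding orthogonal_transformation
  proof (intro conjI allI)
    show "linear (\<lambda>x. \<chi> i::'n. h i \<bullet> x)"
      by (rule linearI) (simp_all add: vec_eq_iff inner_add_right)
    fix x :: "real^'n"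
    \<comment> \<open>Parseval's identity for \<open>B\<close> shows that the map preserves
      norms.\<close>
    have "(\<Sum>i\<in>UNIV. (h i \<bullet> x) * (h i \<bullet> x)) = (\<Sum>b\<in>B. (b \<bullet> x) * (b \<bullet> x))"
      by (rule sum.reindex_bij_betw[OF h])
    also have "\<dots> = (\<Sum>b\<in>B. (x \<bullet> b) *\<^sub>R b) \<bullet> x"
      unfolding inner_sum_left by (simp add: inner_commute)
    also have "\<dots> = x \<bullet> x"
      using orthonormal_basis_expand[OF orth n1 _ fin, of x] sp by simp
    finally show "norm (\<chi> i::'n. h i \<bullet> x) = norm x"
      by (simp add: norm_eq_sqrt_inner inner_vec_def)
  qed
  ultimately show thesis using that h\<iota> by blast
qed

text \<open>The functionals are the coordinates \<open>\<iota> j\<close> of the image of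
  \<open>Z\<close> under an orthogonal map \<open>f\<close> whose rows contain the family, and this
  image has the same law as \<open>Z\<close>.\<close>

lemma (in prob_space) orthonormal_functionals_of_iid_normal:
  fixes Z :: "'a \<Rightarrow> real^'n" and a :: "'j \<Rightarrow> real^'n"
  assumes indep: "indep_vars (\<lambda>_. borel) (\<lambda>i \<omega>. Z \<omega> $ i) UNIV"
    and dist: "\<And>i. distributed M lborel (\<lambda>\<omega>. Z \<omega> $ i) (normal_density 0 \<sigma>)" and \<sigma>: "0 < \<sigma>"
    and J: "finite J" and a: "\<And>i k. i \<in> J \<Longrightarrow> k \<in> J \<Longrightarrow> a i \<bullet> a k = (if i = k then 1 else 0)"
  shows "indep_vars (\<lambda>_. borel) (\<lambda>j \<omega>. a j \<bullet> Z \<omega>) J"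
    and "\<And>j. j \<in> J \<Longrightarrow> distributed M lborel (\<lambda>\<omega>. a j \<bullet> Z \<omega>) (normal_density 0 \<sigma>)"
proof -
  obtain h \<iota> where f: "orthogonal_transformation (\<lambda>x. \<chi> i::'n. h i \<bullet> x)"
    and \<iota>: "inj_on \<iota> J" "\<And>j. j \<in> J \<Longrightarrow> h (\<iota> j) = a j"
    using orthonormal_family_extension[OF J a] by metis
  define f where "f = (\<lambda>x. \<chi> i::'n. h i \<bullet> x)"
  note f = f[folded f_def]
  note nth [measurable] = borel_measurable_vec_nth
  have rv [measurable]: "(\<lambda>\<omega>. Z \<omega> $ i) \<in> borel_measurable M" for i
    using distributed_measurable[OF dist] by simp
  have Z [measurable]: "Z \<in> borel_measurable M"
    by (subst borel_measurable_euclidean_space) (auto simp: Basis_real_vec_eq inner_axis)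
  have f_meas [measurable]: "f \<in> borel_measurable borel"
    using orthogonal_transformation_linear[OF f]
    by (intro borel_measurable_continuous_onI linear_continuous_on) (simp add: linear_conv_bounded_linear)
  have law: "distr M borel (\<lambda>\<omega>. f (Z \<omega>)) = distr M borel Z"
  proof -
    let ?\<phi> = "\<lambda>x::real^'n. \<Prod>i\<in>UNIV. ennreal (normal_density 0 \<sigma> (x $ i))"
    have "distr M borel (\<lambda>\<omega>. f (Z \<omega>)) = distr (distr M borel Z) borel f"
      by (simp add: distr_distr o_def)
    also have "\<dots> = distr (density lborel ?\<phi>) borel f"
      by (simp add: distr_indep_normal_vector[OF indep dist \<sigma>])
    also have "\<dots> = density lborel ?\<phi>"
      by (rule density_orthogonal_transformation_invariant[OF f])
        (simp_all add: prod_normal_density_eq_norm orthogonal_transformation_norm[OF f])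
    finally show ?thesis by (simp add: distr_indep_normal_vector[OF indep dist \<sigma>])
  qed
  have marg: "distr M borel (\<lambda>\<omega>. f (Z \<omega>) $ i) = distr M borel (\<lambda>\<omega>. Z \<omega> $ i)" for i
  proof -
    have "distr (distr M borel (\<lambda>\<omega>. f (Z \<omega>))) borel (\<lambda>x. x $ i) = distr (distr M borel Z) borel (\<lambda>x. x $ i)"
      by (simp only: law)
    then show ?thesis by (simp add: distr_distr o_def)
  qed
  have joint: "distr M (\<Pi>\<^sub>M i\<in>UNIV. borel) (\<lambda>\<omega>. \<lambda>i\<in>UNIV. f (Z \<omega>) $ i)
      = distr M (\<Pi>\<^sub>M i\<in>UNIV. borel) (\<lambda>\<omega>. \<lambda>i\<in>UNIV. Z \<omega> $ i)"
  proof -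
    let ?c = "\<lambda>x::real^'n. \<lambda>i\<in>UNIV. x $ i"
    have "?c \<in> measurable borel (\<Pi>\<^sub>M i\<in>UNIV. borel)" by measurable
    moreover have "distr (distr M borel (\<lambda>\<omega>. f (Z \<omega>))) (\<Pi>\<^sub>M i\<in>UNIV. borel) ?c
        = distr (distr M borel Z) (\<Pi>\<^sub>M i\<in>UNIV. borel) ?c"
      by (simp only: law)
    ultimately show ?thesis by (simp add: distr_distr o_def)
  qed
  \<comment> \<open>Independence says that the joint law is the product of the marginals;
    \<open>joint\<close> and \<open>marg\<close> carry this from \<open>Z\<close> to its
    image.\<close>
  have "indep_vars (\<lambda>_. borel) (\<lambda>i \<omega>. f (Z \<omega>) $ i) UNIV"
  proof (rule indep_vars_iff_distr_eq_PiM[THEN iffD2])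
    have "distr M (\<Pi>\<^sub>M i\<in>UNIV. borel) (\<lambda>\<omega>. \<lambda>i\<in>UNIV. Z \<omega> $ i) = (\<Pi>\<^sub>M i\<in>UNIV. distr M borel (\<lambda>\<omega>. Z \<omega> $ i))"
      by (rule indep_vars_iff_distr_eq_PiM[THEN iffD1, OF _ _ indep]) simp_all
    then show "distr M (\<Pi>\<^sub>M i\<in>UNIV. borel) (\<lambda>\<omega>. \<lambda>i\<in>UNIV. f (Z \<omega>) $ i)
        = (\<Pi>\<^sub>M i\<in>UNIV. distr M borel (\<lambda>\<omega>. f (Z \<omega>) $ i))"
      unfolding joint marg .
  qed simp_all
  then have "indep_vars (\<lambda>_. borel) (\<lambda>j \<omega>. f (Z \<omega>) $ \<iota> j) J"
    by (rule indep_vars_reindex[OF _ \<iota>(1)]) simp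
  moreover have fa: "f (Z \<omega>) $ \<iota> j = a j \<bullet> Z \<omega>" if "j \<in> J" for \<omega> j
    using \<iota>(2)[OF that] by (simp add: f_def)
  ultimately show "indep_vars (\<lambda>_. borel) (\<lambda>j \<omega>. a j \<bullet> Z \<omega>) J"
    by (subst indep_vars_cong[OF refl, of _ _ "\<lambda>j \<omega>. f (Z \<omega>) $ \<iota> j" _ "\<lambda>_. borel"]) auto
  show "distributed M lborel (\<lambda>\<omega>. a j \<bullet> Z \<omega>) (normal_density 0 \<sigma>)" if "j \<in> J" for j
  proof -
    have "distr M lborel (\<lambda>\<omega>. f (Z \<omega>) $ \<iota> j) = distr M lborel (\<lambda>\<omega>. Z \<omega> $ \<iota> j)"
      using marg[of "\<iota> j"] by (simp cong: distr_cong)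
    also have "\<dots> = density lborel (normal_density 0 \<sigma>)"
      by (rule distributed_distr_eq_density[OF dist])
    finally show ?thesis
      using that by (simp add: distributed_def fa)
  qed
qed

section \<open>Optimality of the nodewise regression and the remainder bound\<close>

lemma Jinvertible_scaleR:
  assumes "Jinvertible J A" "c \<noteq> 0"
  shows "Jinvertible J (c *\<^sub>R A)" and "Jinv J (c *\<^sub>R A) = (1 / c) *\<^sub>R Jinv J A"
proof -
  note P = Jinv_props[OF assms(1)]
  have *: "(1 / c) *\<^sub>R Jinv J A \<in> mat_supp J J" "((1 / c) *\<^sub>R Jinv J A) ** (c *\<^sub>R A) = Jid J"
    "(c *\<^sub>R A) ** ((1 / c) *\<^sub>R Jinv J A) = Jid J"
    using P assms(2) by (simp_all add: mat_supp_scaleR matrix_mult_scaleR_left matrix_mult_scaleR_right)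
  show "Jinv J (c *\<^sub>R A) = (1 / c) *\<^sub>R Jinv J A" using * by (rule Jinv_eqI)
  show "Jinvertible J (c *\<^sub>R A)" unfolding Jinvertible_def using * by blast
qed

lemma Xsub_vector_mult_restr: "Xsub X J *v restr J v = Xsub X J *v v"
  by (auto simp: Xsub_def restr_def matrix_vector_mult_def vec_eq_iff intro!: sum.cong)

lemma Xsub_vector_mult_split: "Xsub X J *v v + Xsub X (- J) *v v = X *v v"
  by (auto simp: Xsub_def matrix_vector_mult_def vec_eq_iff sum.distrib[symmetric] intro!: sum.cong)

text \<open>Dual form of optimality. Moving one column of \<open>BJ\<close> by \<open>t d\<close>
  raises the penalty by at most \<open>t * lamJ * g d\<close>, while the nuclear norm falls by
  \<open>t\<close> times the coordinate, up to order \<open>t^2\<close>. Dividing by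
  \<open>t\<close> gives one sign; replacing \<open>d\<close> by \<open>- d\<close> gives the other,
  as the gauge is even.\<close>

lemma nuclear_norm_lasso_KKT:
  fixes X :: "real^'p^'n" and BJ :: "real^'p^'p"
  assumes Om: "is_norm Om" and OmC: "\<And>S. allowed Om S \<Longrightarrow> norm_on (supp_on (- S)) (OmC S)"
    and S: "allowed Om S" and lamJ: "0 \<le> lamJ"
    and BJ: "BJ \<in> mat_supp (- J) J"
    and BJ_min: "\<And>B. B \<in> mat_supp (- J) J \<Longrightarrow>
        nuc (Xsub X J - Xsub X (- J) ** BJ) + lamJ * Psi Om OmC J BJ
          \<le> nuc (Xsub X J - Xsub X (- J) ** B) + lamJ * Psi Om OmC J B"
    and R_def: "R = Xsub X J - Xsub X (- J) ** BJ"
    and inv: "Jinvertible J (psd_sqrt (transpose R ** R))"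
    and j: "j \<in> J" and d: "d \<in> supp_on (- J)"
  shows "\<bar>((Jinv J (psd_sqrt (transpose R ** R)) ** transpose R ** Xsub X (- J)) *v d) $ j\<bar>
      \<le> lamJ * gauge_g Om OmC J d"
proof -
  let ?g = "gauge_g Om OmC J" and ?N = "Jinv J (psd_sqrt (transpose R ** R))"
  let ?F = "?N ** transpose R ** Xsub X (- J)"
  have R: "R \<in> mat_supp UNIV J"
    unfolding R_def by (intro mat_supp_diff Xsub_mat_supp mat_supp_mult[OF Xsub_mat_supp BJ])
  have one_sided: "(?F *v d) $ j \<le> lamJ * ?g d" if d: "d \<in> supp_on (- J)" for d
  proof -
    define E :: "real^'p^'p" where "E = (\<chi> k l. if l = j then d $ k else 0)"
    define C where "C = Xsub X (- J) ** E"
    have E: "E \<in> mat_supp (- J) J"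
      using d j by (auto simp: E_def mat_supp_def supp_on_def)
    have C: "C \<in> mat_supp UNIV J"
      unfolding C_def by (intro mat_supp_mult[OF Xsub_mat_supp E])
    define q where "q = trace (?N ** (transpose C ** C)) / 2"
    have tr: "trace (?N ** transpose R ** C) = (?F *v d) $ j"
      unfolding C_def matrix_mul_assoc E_def by (rule trace_mult_single_column)
    have "(?F *v d) $ j - lamJ * ?g d \<le> t * q" if t: "t > 0" for t
    proof -
      have "nuc R + lamJ * Psi Om OmC J BJ
          \<le> nuc (Xsub X J - Xsub X (- J) ** (BJ + t *\<^sub>R E)) + lamJ * Psi Om OmC J (BJ + t *\<^sub>R E)"
        unfolding R_def using BJ E by (intro BJ_min mat_supp_add mat_supp_scaleR)
      also have "Xsub X J - Xsub X (- J) ** (BJ + t *\<^sub>R E) = R - t *\<^sub>R C"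
        by (simp add: R_def C_def matrix_add_ldistrib matrix_mult_scaleR_right)
      also have "nuc (R - t *\<^sub>R C) \<le> nuc R - t * (?F *v d) $ j + t\<^sup>2 * q"
        using nuc_perturbation_le[OF R C inv, of t] by (simp add: tr q_def)
      also have "lamJ * Psi Om OmC J (BJ + t *\<^sub>R E) \<le> lamJ * (Psi Om OmC J BJ + t * ?g d)"
        unfolding E_def using Psi_add_single_column_le[OF Om OmC S j d t] lamJ by (intro mult_left_mono)
      finally have "t * ((?F *v d) $ j - lamJ * ?g d) \<le> t * (t * q)"
        by (simp add: algebra_simps power2_eq_square)
      then show ?thesis using t by simp
    qed
    then have "(?F *v d) $ j - lamJ * ?g d \<le> 0" by (rule le_zero_if_le_small_multiple)
    then show ?thesis by simp
  qed
  have "- d \<in> supp_on (- J)" using d by (simp add: supp_on_def)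
  from one_sided[OF this] have "- (?F *v d) $ j \<le> lamJ * ?g d"
    using gauge_g_minus[OF Om OmC S, of J d] matrix_vector_mult_scaleR[of ?F "-1" d] by simp
  with one_sided[OF d] show ?thesis by simp
qed

theorem theorem1:
  fixes M :: "'w measure"
    and eps :: "'w \<Rightarrow> real^'n"
    and Y :: "'w \<Rightarrow> real^'n"
    and X :: "real^'p^'n"
    and beta0 :: "real^'p"
    and sigma0 lam lamJ :: real
    and Om :: "real^'p \<Rightarrow> real"
    and OmC :: "'p set \<Rightarrow> real^'p \<Rightarrow> real"
    and betahat :: "'w \<Rightarrow> real^'p"
    and J Sstar :: "'p set"
    and BJ :: "real^'p^'p"
    and R :: "real^'p^'n"
    and SigmaJ TJ MM :: "real^'p^'p"
    and bJ :: "'w \<Rightarrow> real^'p"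
  assumes prob: "prob_space M"
    and sigma_pos: "sigma0 > 0"
    and eps_indep: "prob_space.indep_vars M (\<lambda>_. borel) (\<lambda>i \<omega>. eps \<omega> $ i) UNIV"
    and eps_distr: "\<And>i. distributed M lborel (\<lambda>\<omega>. eps \<omega> $ i) (normal_density 0 sigma0)"
    and model: "\<And>\<omega>. \<omega> \<in> space M \<Longrightarrow> Y \<omega> = X *v beta0 + eps \<omega>"
    and Om_norm: "is_norm Om"
    and OmC_norm: "\<And>S. allowed Om S \<Longrightarrow> norm_on (supp_on (- S)) (OmC S)
                     \<and> (\<forall>\<beta>. Om (restr S \<beta>) + OmC S (restr (- S) \<beta>) \<le> Om \<beta>)"
    and lam_pos: "lam > 0"
    and betahat_min: "\<And>\<omega> \<beta>. \<omega> \<in> space M \<Longrightarrow>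
        sqnorm_n (Y \<omega> - X *v betahat \<omega>) + lam * Om (betahat \<omega>)
          \<le> sqnorm_n (Y \<omega> - X *v \<beta>) + lam * Om \<beta>"
    and lamJ_pos: "lamJ > 0"
    and BJ_supp: "BJ \<in> mat_supp (- J) J"
    and BJ_min: "\<And>B. B \<in> mat_supp (- J) J \<Longrightarrow>
        nuc (Xsub X J - Xsub X (- J) ** BJ) + lamJ * Psi Om OmC J BJ
          \<le> nuc (Xsub X J - Xsub X (- J) ** B) + lamJ * Psi Om OmC J B"
    and R_def: "R = Xsub X J - Xsub X (- J) ** BJ"
    and R_nz: "nuc R \<noteq> 0"
    and Sigma_def: "SigmaJ = (1 / real CARD('n)) *\<^sub>R (transpose R ** R)"
    and Sigma_inv: "Jinvertible J SigmaJ"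
    and T_def: "TJ = (1 / real CARD('n)) *\<^sub>R (transpose R ** Xsub X J)"
    and T_inv: "Jinvertible J TJ"
    and M_def: "MM = sqrt (real CARD('n)) *\<^sub>R (Jinv J (psd_sqrt SigmaJ) ** TJ)"
    and b_def: "\<And>\<omega>. bJ \<omega> = restr J (betahat \<omega>)
        + (1 / real CARD('n)) *\<^sub>R (Jinv J TJ *v (transpose R *v (Y \<omega> - X *v betahat \<omega>)))"
    and Sstar_allowed: "allowed Om Sstar"
  shows "\<exists>W :: 'w \<Rightarrow> real^'p.
     prob_space.indep_vars M (\<lambda>_. borel) (\<lambda>j \<omega>. W \<omega> $ j) J
     \<and> (\<forall>j\<in>J. distributed M lborel (\<lambda>\<omega>. W \<omega> $ j) std_normal_density)
     \<and> (\<forall>\<omega>\<in>space M.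
          let rem = (1 / sigma0) *\<^sub>R (MM *v (bJ \<omega> - restr J beta0)) - W \<omega> in
          (MAX j\<in>J. \<bar>rem $ j\<bar>)
            \<le> sqrt (real CARD('n)) * lamJ
                * gauge_g Om OmC J (restr (- J) (betahat \<omega>) - restr (- J) beta0) / sigma0
          \<and> sqrt (real CARD('n)) * lamJ
                * gauge_g Om OmC J (restr (- J) (betahat \<omega>) - restr (- J) beta0) / sigma0
            \<le> sqrt (real CARD('n)) * lamJ * Upsilon Om OmC Sstar (betahat \<omega> - beta0) / sigma0)"
proof -
  interpret prob_space M by (rule prob)
  let ?n = "real CARD('n)" and ?g = "gauge_g Om OmC J"
  define Q where "Q = psd_sqrt (transpose R ** R)"
  define N where "N = Jinv J Q"
  define A where "A = N ** transpose R"
  have n0: "?n > 0" and n1: "sqrt ?n \<ge> 1" by (simp_all add: Suc_le_eq)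
  have OmC: "norm_on (supp_on (- S)) (OmC S)" if "allowed Om S" for S
    using OmC_norm[OF that] by simp
  have R: "R \<in> mat_supp UNIV J"
    unfolding R_def by (intro mat_supp_diff Xsub_mat_supp mat_supp_mult[OF Xsub_mat_supp BJ_supp])
  \<comment> \<open>Rescaling by \<open>n\<close> passes from the covariance to the Gram matrix of
    \<open>R\<close>, whose root \<open>Q\<close> is the one in the nuclear norm.\<close>
  have "Jinvertible J (?n *\<^sub>R SigmaJ)"
    using Jinvertible_scaleR(1)[OF Sigma_inv, of ?n] n0 by simp
  then have Q_inv: "Jinvertible J Q"
    unfolding Q_def using n0 by (intro Jinvertible_psd_sqrt_gram[OF R]) (simp add: Sigma_def)
  have N: "N \<in> mat_supp J J" "N ** Q = Jid J" "Q ** N = Jid J"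
    unfolding N_def by (rule Jinv_props[OF Q_inv])+
  have N_sym: "transpose N = N"
    unfolding N_def using Q_inv psd_sqrt_gram(1)[of R] psd_sqrt_gram(2)[of _ R] unfolding Q_def
    by (intro Jinv_symmetric_psd(1)) auto
  \<comment> \<open>Inverting this root produces a factor \<open>sqrt n\<close>, which combines with
    the one in \<open>MM\<close> to \<open>n\<close> and later cancels the \<open>1 / n\<close> in
    \<open>TJ\<close>.\<close>
  have "psd_sqrt SigmaJ = sqrt (1 / ?n) *\<^sub>R Q"
    unfolding Sigma_def Q_def by (rule psd_sqrt_scaleR_gram) simp
  then have "Jinv J (psd_sqrt SigmaJ) = sqrt ?n *\<^sub>R N"
    using Jinvertible_scaleR(2)[OF Q_inv, of "sqrt (1 / ?n)"] n0 by (simp add: N_def real_sqrt_divide)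
  then have MM: "MM = ?n *\<^sub>R (N ** TJ)"
    by (simp add: M_def matrix_mult_scaleR_left)
  have gram: "A ** transpose A = Jid J"
  proof -
    have "A ** transpose A = N ** (transpose R ** R) ** N"
      by (simp add: A_def matrix_transpose_mul N_sym matrix_mul_assoc)
    also have "transpose R ** R = Q ** Q" by (simp add: Q_def psd_sqrt_gram(3))
    also have "N ** (Q ** Q) ** N = (N ** Q) ** (Q ** N)" by (simp add: matrix_mul_assoc)
    also have "\<dots> = Jid J"
      by (simp add: N) (rule Jid_mult_left[where K=J], simp add: mat_supp_def Jid_def)
    finally show ?thesis .
  qed
  have orth: "A $ i \<bullet> A $ k = (if i = k then 1 else 0)" if "i \<in> J" "k \<in> J" for i k
  proof -
    have "A $ i \<bullet> A $ k = (A ** transpose A) $ i $ k"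
      by (simp add: matrix_matrix_mult_def transpose_def inner_vec_def)
    then show ?thesis using that by (simp add: gram Jid_def)
  qed
  \<comment> \<open>The maximum over an empty set is unspecified; a nonzero nuclear norm rules this
    case out.\<close>
  have J_ne: "J \<noteq> {}"
  proof
    assume "J = {}"
    then have "R = 0" using R by (simp add: mat_supp_def vec_eq_iff)
    with R_nz show False by (simp add: nuc_zero)
  qed
  \<comment> \<open>The witness is the noise part of the expansion, so that the remainder is exactly
    the bias part.\<close>
  define W where "W = (\<lambda>\<omega>. (1 / sigma0) *\<^sub>R (A *v eps \<omega>))"
  have W: "W \<omega> $ j = (A $ j \<bullet> eps \<omega>) / sigma0" for \<omega> j
    by (simp add: W_def matrix_mult_dot)
  have normals: "indep_vars (\<lambda>_. borel) (\<lambda>j \<omega>. A $ j \<bullet> eps \<omega>) J"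
    "\<And>j. j \<in> J \<Longrightarrow> distributed M lborel (\<lambda>\<omega>. A $ j \<bullet> eps \<omega>) (normal_density 0 sigma0)"
    using orthonormal_functionals_of_iid_normal[OF eps_indep eps_distr sigma_pos finite, of J "\<lambda>j. A $ j"] orth
    by auto
  have "indep_vars (\<lambda>_. borel) (\<lambda>j \<omega>. W \<omega> $ j) J"
    unfolding W using normals(1) by (rule indep_vars_compose2) auto
  moreover have "distributed M lborel (\<lambda>\<omega>. W \<omega> $ j) std_normal_density" if "j \<in> J" for j
    using normals(2)[OF that] normal_standard_normal_convert[OF sigma_pos, of _ 0] by (simp add: W)
  moreover have "(MAX j\<in>J. \<bar>((1 / sigma0) *\<^sub>R (MM *v (bJ \<omega> - restr J beta0)) - W \<omega>) $ j\<bar>)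
      \<le> sqrt ?n * lamJ * ?g (restr (- J) (betahat \<omega>) - restr (- J) beta0) / sigma0" if \<omega>: "\<omega> \<in> space M" for \<omega>
  proof -
    define v where "v = betahat \<omega> - beta0"
    define d where "d = restr (- J) v"
    have d: "restr (- J) (betahat \<omega>) - restr (- J) beta0 = d"
      by (simp add: d_def v_def restr_diff)
    have nT: "?n *\<^sub>R (N ** TJ) = A ** Xsub X J"
      using n0 by (simp add: T_def A_def matrix_mult_scaleR_right matrix_mul_assoc)
    have NTT: "(N ** TJ) ** Jinv J TJ = N"
      using Jinv_props(3)[OF T_inv] Jid_mult_right[OF N(1)] by (simp add: matrix_mul_assoc[symmetric])
    have "Y \<omega> - X *v betahat \<omega> = eps \<omega> - X *v v"
      by (simp add: model[OF \<omega>] v_def matrix_vector_mult_diff_distrib)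
    then have b: "bJ \<omega> - restr J beta0
        = restr J v + (1 / ?n) *\<^sub>R (Jinv J TJ *v (transpose R *v (eps \<omega> - X *v v)))"
      by (simp only: b_def v_def restr_diff) simp
    have "MM *v (bJ \<omega> - restr J beta0)
        = (?n *\<^sub>R (N ** TJ)) *v restr J v + ((N ** TJ) ** Jinv J TJ ** transpose R) *v (eps \<omega> - X *v v)"
      using n0 unfolding MM b
      by (simp only: matrix_vector_right_distrib matrix_vector_mult_scaleR
          matrix_vector_mul_assoc)
        (simp add: matrix_mult_scaleR_left scaleR_matrix_vector_assoc[symmetric] matrix_mul_assoc)
    also have "\<dots> = A *v (Xsub X J *v v) + A *v (eps \<omega> - X *v v)"
      unfolding nT NTT A_def[symmetric] by (simp only: matrix_vector_mul_assoc[symmetric] Xsub_vector_mult_restr)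
    \<comment> \<open>The correction term cancels the part of \<open>X *v v\<close> on
      \<open>J\<close> exactly, leaving a bias that depends only on coordinates outside
      \<open>J\<close>.\<close>
    also have "\<dots> = A *v eps \<omega> - A *v (Xsub X (- J) *v v)"
      unfolding Xsub_vector_mult_split[of X J v, symmetric]
      by (simp only: matrix_vector_mult_diff_distrib matrix_vector_right_distrib) simp
    also have "A *v (Xsub X (- J) *v v) = (A ** Xsub X (- J)) *v d"
      by (simp only: d_def matrix_vector_mul_assoc[symmetric] Xsub_vector_mult_restr)
    finally have rem: "(1 / sigma0) *\<^sub>R (MM *v (bJ \<omega> - restr J beta0)) - W \<omega>
        = - (1 / sigma0) *\<^sub>R ((A ** Xsub X (- J)) *v d)"
      by (simp add: W_def scaleR_diff_right)
    have "\<bar>((1 / sigma0) *\<^sub>R (MM *v (bJ \<omega> - restr J beta0)) - W \<omega>) $ j\<bar> \<le> sqrt ?n * lamJ * ?g d / sigma0"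
      if j: "j \<in> J" for j
    proof -
      have "\<bar>((A ** Xsub X (- J)) *v d) $ j\<bar> \<le> lamJ * ?g d"
        unfolding A_def N_def Q_def
        using nuclear_norm_lasso_KKT[OF Om_norm OmC Sstar_allowed _ BJ_supp BJ_min R_def
            Q_inv[unfolded Q_def] j restr_in_supp_on] lamJ_pos
        unfolding d_def by simp
      \<comment> \<open>Optimality bounds the coordinate without \<open>sqrt n\<close>; the gauge is
        nonnegative, so a factor of at least 1 only enlarges the bound.\<close>
      also have "\<dots> \<le> sqrt ?n * (lamJ * ?g d)"
        using mult_right_mono[OF n1, of "lamJ * ?g d"] lamJ_pos
          gauge_g_nonneg[OF Om_norm OmC Sstar_allowed, of J d] by simp
      finally have "\<bar>((A ** Xsub X (- J)) *v d) $ j\<bar> / sigma0 \<le> sqrt ?n * (lamJ * ?g d) / sigma0"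
        using sigma_pos by (simp add: divide_right_mono)
      then show ?thesis
        unfolding rem using sigma_pos by (simp add: abs_mult mult.assoc)
    qed
    then show ?thesis
      unfolding d using J_ne by (subst Max_le_iff) auto
  qed
  moreover have "sqrt ?n * lamJ * ?g (restr (- J) (betahat \<omega>) - restr (- J) beta0) / sigma0
      \<le> sqrt ?n * lamJ * Upsilon Om OmC Sstar (betahat \<omega> - beta0) / sigma0" for \<omega>
    using gauge_g_restr_le_Upsilon[OF Om_norm OmC Sstar_allowed, of J "betahat \<omega> - beta0"] lamJ_pos sigma_pos
    by (simp add: restr_diff divide_right_mono mult_left_mono)
  ultimately show ?thesis
    unfolding Let_def by blast
qed

end
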